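(* For every integer $r \geq 6$ there exist $n_0=n_0(r)$ and a constant $c=c(r)$ such that the following holds. For any graph $G$ on $n\geq n_0$ vertices there is a collection $\mathcal{C}$ of $r$-templates of $G$ such that: (1) every rainbow-$K_4$-free $r$-edge-coloring of $G$ (viewed as the template $e\mapsto\{\phi(e)\}$) is a subtemplate of some $L\in\mathcal{C}$; (2) for every $L\in\mathcal{C}$, the number of rainbow copies of $K_4$ in $L$ is at most $r^{4} n^{-1/3}\binom{n}{4}$; (3) $|\mathcal{C}|\leq 2^{c\, n^{-1/3}\binom{n}{2}\log^2 n}$.
   Context: An $r$-template of a graph $G$ is a function $L\colon E(G)\to 2^{\{1,\dots,r\}}$ assigning to each edge $e$ a list of colors $L(e)$. For two $r$-templates $L_1,L_2$ of $G$, $L_1$ is a subtemplate of $L_2$ if $L_1(e)\subseteq L_2(e)$ for every edge $e$. A rainbow copy of $K_4$ in a template $L$ is a set $\{(e_1,c_1),\dots,(e_6,c_6)\}$ such that $e_1,\dots,e_6$ are the edges of a copy of $K_4$ in $G$, and $c_1,\dots,c_6$ are pairwise distinct colors with $c_i\in L(e_i)$ for each $i$. An $r$-edge-coloring $\phi\colon E(G)\to\{1,\dots,r\}$ is rainbow-$K_4$-free if no copy of $K_4$ in $G$ has six pairwise distinct edge colors. *)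

theory Defs
  imports Complex_Main "HOL-Library.FuncSet" "HOL-Library.Ramsey"
begin

definition simple_graph :: "'a set \<Rightarrow> 'a set set \<Rightarrow> bool" where
  "simple_graph V E \<longleftrightarrow> finite V \<and> E \<subseteq> [V]\<^bsup>2\<^esup>"

text \<open>Templates are extensional (undefined off the edge set), so that templates which agree on
  all edges are equal and the cardinality of a collection of templates is meaningful.\<close>

definition templates :: "nat \<Rightarrow> 'a set set \<Rightarrow> ('a set \<Rightarrow> nat set) set" where
  "templates r E = E \<rightarrow>\<^sub>E Pow {1..r}"

definition subtemplate :: "'a set set \<Rightarrow> ('a set \<Rightarrow> nat set) \<Rightarrow> ('a set \<Rightarrow> nat set) \<Rightarrow> bool" where
  "subtemplate E L1 L2 \<longleftrightarrow> (\<forall>e\<in>E. L1 e \<subseteq> L2 e)"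

text \<open>A copy of the complete graph on 4 vertices is represented by its set of six edges.\<close>

definition K4_copies :: "'a set \<Rightarrow> 'a set set \<Rightarrow> 'a set set set" where
  "K4_copies V E = {[K]\<^bsup>2\<^esup> | K. K \<in> [V]\<^bsup>4\<^esup> \<and> [K]\<^bsup>2\<^esup> \<subseteq> E}"

definition rainbow_K4_copies ::
    "'a set \<Rightarrow> 'a set set \<Rightarrow> ('a set \<Rightarrow> nat set) \<Rightarrow> ('a set \<times> nat) set set" where
  "rainbow_K4_copies V E L =
     {(\<lambda>e. (e, c e)) ` F | F c. F \<in> K4_copies V E \<and> inj_on c F \<and> (\<forall>e\<in>F. c e \<in> L e)}"

definition edge_colorings :: "nat \<Rightarrow> 'a set set \<Rightarrow> ('a set \<Rightarrow> nat) set" where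
  "edge_colorings r E = E \<rightarrow>\<^sub>E {1..r}"

definition rainbow_K4_free :: "'a set \<Rightarrow> 'a set set \<Rightarrow> ('a set \<Rightarrow> nat) \<Rightarrow> bool" where
  "rainbow_K4_free V E \<phi> \<longleftrightarrow> \<not> (\<exists>F\<in>K4_copies V E. inj_on \<phi> F)"

definition coloring_template :: "'a set set \<Rightarrow> ('a set \<Rightarrow> nat) \<Rightarrow> 'a set \<Rightarrow> nat set" where
  "coloring_template E \<phi> = (\<lambda>e\<in>E. {\<phi> e})"

end

theory Submission
  imports Defs
begin

text \<open>Colorings are independent sets of the 6-uniform hypergraph of rainbow copies of \<open>K\<^sub>4\<close> on the
  vertex set of pairs (edge, color). One container step works with a weighted hypergraph \<open>H\<close> whose
  codegrees satisfy \<open>d(S) \<le> K \<Prod>\<^bsub>v\<in>S\<^esub> q v\<close>. Starting from \<open>G = 0\<close>, links of vertices of the independent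
  set are added to \<open>G\<close>, each scaled by \<open>1 / q v\<close> and restricted to sets on which \<open>G\<close> is not yet
  saturated. Either \<open>G\<close> becomes heavy, and one recurses with uniformity one less, or no vertex of the
  independent set contributes much, and then the vertices contributing little form a container.
  Taking \<open>q\<close> proportional to \<open>\<tau>\<close> times a small constant plus the relative degree, with \<open>\<tau>\<close> of order
  \<open>n^(-1/3)\<close>, each step loses a fixed proportion of the rainbow copies, so \<open>O(log n)\<close> steps suffice;
  each contributes a factor \<open>2\<close> to the power \<open>O(n^(5/3) log n)\<close> to the number of containers.\<close>

section \<open>Weighted hypergraphs: codegrees, saturation and links\<close>

definition codegree :: "'b set \<Rightarrow> ('b set \<Rightarrow> real) \<Rightarrow> 'b set \<Rightarrow> real" where
  "codegree V H S = (\<Sum>F\<in>{F\<in>Pow V. S \<subseteq> F}. H F)"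

definition uniform_weight :: "'b set \<Rightarrow> nat \<Rightarrow> ('b set \<Rightarrow> real) \<Rightarrow> bool" where
  "uniform_weight V s H \<longleftrightarrow> (\<forall>F. 0 \<le> H F \<and> (H F \<noteq> 0 \<longrightarrow> F \<subseteq> V \<and> card F = s))"

text \<open>For constant \<open>q\<close> this is the usual requirement that codegrees decay
  geometrically in the size of \<open>S\<close>. Letting \<open>q\<close> vary with the vertex makes
  it usable for irregular hypergraphs: for \<open>S = {v}\<close> it bounds the degree of
  \<open>v\<close> by \<open>K * q v\<close>.\<close>

definition bounded_weight :: "'b set \<Rightarrow> ('b \<Rightarrow> real) \<Rightarrow> real \<Rightarrow> ('b set \<Rightarrow> real) \<Rightarrow> bool" where
  "bounded_weight V q K H \<longleftrightarrow> (\<forall>S. S \<subseteq> V \<and> S \<noteq> {} \<longrightarrow> codegree V H S \<le> K * prod q S)"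

definition independent_in :: "('b set \<Rightarrow> real) \<Rightarrow> 'b set \<Rightarrow> bool" where
  "independent_in H I \<longleftrightarrow> (\<forall>F\<subseteq>I. H F = 0)"

text \<open>A set \<open>F\<close> is saturated once some subset of it has codegree in \<open>G\<close> so large that adding one
  more link could violate the codegree bound maintained for \<open>G\<close>.\<close>

definition unsaturated :: "'b set \<Rightarrow> ('b \<Rightarrow> real) \<Rightarrow> real \<Rightarrow> ('b set \<Rightarrow> real) \<Rightarrow> 'b set \<Rightarrow> bool" where
  "unsaturated V q K G F \<longleftrightarrow> (\<forall>S. S \<subseteq> F \<and> S \<noteq> {} \<longrightarrow> codegree V G S \<le> K * prod q S)"

text \<open>The factor \<open>1 / q v\<close> turns the bound for \<open>insert v S\<close> in
  \<open>H\<close> into one for \<open>S\<close> with the same constant \<open>K\<close>. The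
  predicate \<open>U\<close> selects the sets that may still receive weight.\<close>

definition add_link ::
    "('b \<Rightarrow> real) \<Rightarrow> ('b set \<Rightarrow> bool) \<Rightarrow> ('b set \<Rightarrow> real) \<Rightarrow> 'b \<Rightarrow> ('b set \<Rightarrow> real) \<Rightarrow> 'b set \<Rightarrow> real" where
  "add_link q U H v G F = G F + (if v \<notin> F \<and> U F then H (insert v F) / q v else 0)"

text \<open>Before division by \<open>q v\<close>, this is the total weight that adding the link of
  \<open>v\<close> contributes.\<close>

definition link_gain :: "'b set \<Rightarrow> ('b set \<Rightarrow> bool) \<Rightarrow> ('b set \<Rightarrow> real) \<Rightarrow> 'b \<Rightarrow> real" where
  "link_gain V U H v = (\<Sum>F\<in>{F\<in>Pow V. v \<in> F \<and> U (F - {v})}. H F)"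

lemma unsaturated_mono: "unsaturated V q K G F \<Longrightarrow> F' \<subseteq> F \<Longrightarrow> unsaturated V q K G F'"
  unfolding unsaturated_def by blast

lemma sum_UNION_le:
  fixes f :: "'b \<Rightarrow> real"
  assumes "finite I" "\<And>i. i \<in> I \<Longrightarrow> finite (A i)" "\<And>x. 0 \<le> f x"
  shows "sum f (\<Union>i\<in>I. A i) \<le> (\<Sum>i\<in>I. sum f (A i))"
  using assms(1,2)
proof (induction I rule: finite_induct)
  case (insert i I)
  have "sum f (A i \<union> (\<Union>i\<in>I. A i)) \<le> sum f (A i) + sum f (\<Union>i\<in>I. A i)"
    using insert assms(3) by (subst sum_Un) (auto simp: sum_nonneg)
  moreover have "sum f (\<Union>i\<in>I. A i) \<le> (\<Sum>i\<in>I. sum f (A i))"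
    using insert by simp
  ultimately show ?case using insert(1,2) by simp
qed simp

lemma codegree_nonneg: "uniform_weight V s H \<Longrightarrow> 0 \<le> codegree V H S"
  unfolding codegree_def uniform_weight_def by (simp add: sum_nonneg)

lemma sum_add_link:
  assumes "finite V" "v \<in> V"
  shows "sum (add_link q U H v G) (Pow V) = sum G (Pow V) + link_gain V U H v / q v"
proof -
  have "(\<Sum>F\<in>Pow V. if v \<notin> F \<and> U F then H (insert v F) / q v else 0)
      = (\<Sum>F\<in>{F\<in>Pow V. v \<notin> F \<and> U F}. H (insert v F) / q v)"
    using assms by (subst sum.inter_filter) auto
  also have "\<dots> = (\<Sum>F\<in>{F\<in>Pow V. v \<in> F \<and> U (F - {v})}. H F / q v)"
    by (rule sum.reindex_bij_witness[where i="\<lambda>F. F - {v}" and j="insert v"])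
       (use assms in \<open>auto simp: insert_absorb\<close>)
  also have "\<dots> = link_gain V U H v / q v"
    unfolding link_gain_def by (simp add: sum_divide_distrib)
  finally show ?thesis
    unfolding add_link_def by (simp add: sum.distrib)
qed

lemma uniform_weight_add_link:
  assumes "finite V" "uniform_weight V (Suc s) H" "uniform_weight V s G" "q v > 0"
  shows "uniform_weight V s (add_link q U H v G)"
  unfolding uniform_weight_def
proof (intro allI conjI impI)
  fix F
  have nn: "0 \<le> G F" "0 \<le> H (insert v F)"
    using assms unfolding uniform_weight_def by auto
  show "0 \<le> add_link q U H v G F"
    unfolding add_link_def using nn assms by auto
  assume "add_link q U H v G F \<noteq> 0"
  then consider "G F \<noteq> 0" | "v \<notin> F" "H (insert v F) \<noteq> 0"
    unfolding add_link_def by (cases "G F = 0") (auto split: if_splits)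
  then have "F \<subseteq> V \<and> card F = s"
  proof cases
    case 1
    then show ?thesis using assms unfolding uniform_weight_def by auto
  next
    case 2
    then have "insert v F \<subseteq> V" "card (insert v F) = Suc s"
      using assms unfolding uniform_weight_def by blast+
    moreover from this have "finite F" using assms(1) finite_subset by auto
    ultimately show ?thesis using 2 by simp
  qed
  then show "F \<subseteq> V" "card F = s" by auto
qed

text \<open>If \<open>F\<close> lies in \<open>I\<close>, so does \<open>insert v F\<close>, because
  \<open>v\<close> belongs to \<open>I\<close>. Hence a link may be added once \<open>v\<close> is
  known to be in \<open>I\<close>, which is why the construction branches on elements of the
  independent set.\<close>

lemma independent_in_add_link:
  assumes "independent_in H I" "independent_in G I" "v \<in> I"
  shows "independent_in (add_link q U H v G) I"
  using assms unfolding independent_in_def add_link_def by auto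

text \<open>If \<open>S\<close> is saturated or contains \<open>v\<close>, nothing is added above
  \<open>S\<close>, since supersets of saturated sets are saturated. Otherwise the codegree of
  \<open>S\<close> is at most \<open>(K' - K) * prod q S\<close>, and one link adds at most
  \<open>K * prod q S\<close>.\<close>

lemma bounded_weight_add_link:
  assumes fin: "finite V" and v: "v \<in> V" and q: "\<And>x. x \<in> V \<Longrightarrow> q x > 0"
    and H: "uniform_weight V s' H" "bounded_weight V q K H"
    and G: "bounded_weight V q K' G"
  shows "bounded_weight V q K' (add_link q (unsaturated V q (K' - K) G) H v G)"
  unfolding bounded_weight_def
proof (intro allI impI)
  fix S assume S: "S \<subseteq> V \<and> S \<noteq> {}"
  let ?U = "unsaturated V q (K' - K) G"
  let ?inc = "\<Sum>F\<in>{F\<in>Pow V. S \<subseteq> F}. if v \<notin> F \<and> ?U F then H (insert v F) / q v else 0"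
  have eq: "codegree V (add_link q ?U H v G) S = codegree V G S + ?inc"
    unfolding codegree_def add_link_def by (simp add: sum.distrib)
  have qv: "q v > 0" using q v by auto
  have pq: "prod q S \<ge> 0" using S q by (intro prod_nonneg) (force intro: less_imp_le)
  have GS: "codegree V G S \<le> K' * prod q S"
    using G S unfolding bounded_weight_def by blast
  show "codegree V (add_link q ?U H v G) S \<le> K' * prod q S"
  proof (cases "?U S \<and> v \<notin> S")
    case False
    have "?inc = 0"
      by (rule sum.neutral) (use False unsaturated_mono in \<open>auto; blast\<close>)
    then show ?thesis using eq GS by simp
  next
    case True
    have "codegree V G S \<le> (K' - K) * prod q S"
      using True S unfolding unsaturated_def by blast
    moreover have "?inc \<le> K * prod q S"
    proof -
      have "?inc = (\<Sum>F\<in>{F\<in>Pow V. S \<subseteq> F \<and> v \<notin> F \<and> ?U F}. H (insert v F) / q v)"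
        using fin by (subst sum.inter_filter[symmetric]) (auto intro!: sum.cong)
      also have "\<dots> = (\<Sum>F\<in>insert v ` {F\<in>Pow V. S \<subseteq> F \<and> v \<notin> F \<and> ?U F}. H F / q v)"
        by (subst sum.reindex) (auto simp: inj_on_def)
      also have "\<dots> \<le> (\<Sum>F\<in>{F\<in>Pow V. insert v S \<subseteq> F}. H F / q v)"
        using fin v H(1) qv by (intro sum_mono2) (auto simp: uniform_weight_def)
      also have "\<dots> = codegree V H (insert v S) / q v"
        unfolding codegree_def by (simp add: sum_divide_distrib)
      also have "\<dots> \<le> K * prod q (insert v S) / q v"
        using H(2) S v qv unfolding bounded_weight_def
        by (intro divide_right_mono) auto
      also have "\<dots> = K * prod q S"
        using True S fin qv finite_subset[of S V] by simp
      finally show ?thesis .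
    qed
    ultimately show ?thesis using eq by (simp add: algebra_simps)
  qed
qed

text \<open>A union bound over the saturated sets \<open>S\<close>. For each of them the codegree in
  \<open>H\<close> is at most \<open>K * prod q S\<close>, hence at most the codegree in
  \<open>G\<close> divided by \<open>A\<close>. Summing the codegrees of \<open>G\<close> over all
  \<open>S\<close> counts each edge once per subset, that is \<open>2 ^ s\<close> times.\<close>

lemma saturated_weight_le:
  assumes fin: "finite V" and q: "\<And>x. x \<in> V \<Longrightarrow> q x > 0"
    and H: "uniform_weight V s' H" "bounded_weight V q K H" and "K > 0"
    and G: "uniform_weight V s G" and A: "A > 0"
  shows "(\<Sum>F\<in>{F\<in>Pow V. \<not> unsaturated V q (A * K) G F}. H F) \<le> 2 ^ s / A * sum G (Pow V)"
proof -
  let ?Sat = "{S\<in>Pow V. S \<noteq> {} \<and> \<not> codegree V G S \<le> A * K * prod q S}"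
  have finS: "finite ?Sat" using fin by auto
  have Hnn: "\<And>F. H F \<ge> 0" using H unfolding uniform_weight_def by auto
  have Gnn: "\<And>F. G F \<ge> 0" using G unfolding uniform_weight_def by auto
  have sub: "{F\<in>Pow V. \<not> unsaturated V q (A * K) G F} \<subseteq> (\<Union>S\<in>?Sat. {F\<in>Pow V. S \<subseteq> F})"
    unfolding unsaturated_def by blast
  have "(\<Sum>F\<in>{F\<in>Pow V. \<not> unsaturated V q (A * K) G F}. H F) \<le> (\<Sum>F\<in>(\<Union>S\<in>?Sat. {F\<in>Pow V. S \<subseteq> F}). H F)"
    using fin Hnn sub by (intro sum_mono2) auto
  also have "\<dots> \<le> (\<Sum>S\<in>?Sat. codegree V H S)"
    unfolding codegree_def using finS fin Hnn by (intro sum_UNION_le) auto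
  also have "\<dots> \<le> (\<Sum>S\<in>?Sat. codegree V G S / A)"
  proof (rule sum_mono)
    fix S assume S: "S \<in> ?Sat"
    then have "codegree V H S \<le> K * prod q S"
      using H(2) unfolding bounded_weight_def by auto
    also have "\<dots> \<le> codegree V G S / A"
      using S A by (auto simp: field_simps)
    finally show "codegree V H S \<le> codegree V G S / A" .
  qed
  also have "\<dots> \<le> (\<Sum>S\<in>Pow V. codegree V G S / A)"
    using fin A codegree_nonneg[OF G] by (intro sum_mono2) auto
  also have "\<dots> = (\<Sum>S\<in>Pow V. \<Sum>F\<in>Pow V. if S \<subseteq> F then G F else 0) / A"
    unfolding codegree_def sum_divide_distrib[symmetric]
    using fin by (subst sum.inter_filter) auto
  also have "\<dots> = (\<Sum>F\<in>Pow V. \<Sum>S\<in>Pow V. if S \<subseteq> F then G F else 0) / A"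
    by (subst sum.swap) simp
  also have "(\<Sum>F\<in>Pow V. \<Sum>S\<in>Pow V. if S \<subseteq> F then G F else 0) = (\<Sum>F\<in>Pow V. 2 ^ s * G F)"
  proof (rule sum.cong[OF refl])
    fix F assume F: "F \<in> Pow V"
    have "(\<Sum>S\<in>Pow V. if S \<subseteq> F then G F else 0) = (\<Sum>S\<in>{S\<in>Pow V. S \<subseteq> F}. G F)"
      using fin by (subst sum.inter_filter) auto
    also have "{S\<in>Pow V. S \<subseteq> F} = Pow F" using F by auto
    also have "(\<Sum>S\<in>Pow F. G F) = 2 ^ card F * G F"
      using F fin finite_subset[of F V] by (simp add: card_Pow)
    also have "\<dots> = 2 ^ s * G F"
      using G unfolding uniform_weight_def by (cases "G F = 0") auto
    finally show "(\<Sum>S\<in>Pow V. if S \<subseteq> F then G F else 0) = 2 ^ s * G F" .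
  qed
  finally show ?thesis by (simp add: sum_distrib_left[symmetric])
qed

text \<open>The weight of \<open>H\<close> is at least \<open>c * sum q V\<close>. Saturated edges
  carry at most a quarter of this, because the factor \<open>4 * 2 ^ k\<close> beats the
  \<open>2 ^ s\<close> of the union bound; the vertices of \<open>C\<close> account for at most
  another quarter by definition. The rest is carried by vertices outside \<open>C\<close>, whose
  degrees are at most \<open>K * q v\<close>, so their \<open>q\<close>-weight cannot be
  small.\<close>

lemma low_gain_set:
  assumes fin: "finite V" and q: "\<And>x. x \<in> V \<Longrightarrow> q x > 0"
    and H: "uniform_weight V (Suc s) H" "bounded_weight V q K H" and "K > 0"
    and G: "uniform_weight V s G" and c: "c > 0"
    and WH: "c * sum q V \<le> sum H (Pow V)" and WG: "sum G (Pow V) \<le> c * sum q V"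
    and C: "C = {v\<in>V. link_gain V (unsaturated V q (4 * 2 ^ k * K) G) H v < c / 4 * q v}"
    and sk: "s \<le> k"
  shows "c / (4 * K) * sum q V \<le> sum q (V - C)"
proof -
  let ?U = "unsaturated V q (4 * 2 ^ k * K) G"
  let ?Q = "sum q V"
  have Hnn: "\<And>F. H F \<ge> 0" using H unfolding uniform_weight_def by auto
  have Gnn: "sum G (Pow V) \<ge> 0" using G unfolding uniform_weight_def by (simp add: sum_nonneg)
  have CV: "C \<subseteq> V" using C by auto
  have "(\<Sum>F\<in>{F\<in>Pow V. \<not> ?U F}. H F) \<le> 2 ^ s / (4 * 2 ^ k) * sum G (Pow V)"
    by (rule saturated_weight_le[OF fin q H \<open>K > 0\<close> G]) auto
  also have "\<dots> \<le> 1 / 4 * sum G (Pow V)"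
    using sk power_increasing[OF sk, of "2::real"] Gnn by (intro mult_right_mono) (auto simp: field_simps)
  also have "\<dots> \<le> c / 4 * ?Q" using WG by simp
  finally have sat: "(\<Sum>F\<in>{F\<in>Pow V. \<not> ?U F}. H F) \<le> c / 4 * ?Q" .
  have split: "sum H (Pow V) = (\<Sum>F\<in>{F\<in>Pow V. ?U F}. H F) + (\<Sum>F\<in>{F\<in>Pow V. \<not> ?U F}. H F)"
    by (subst sum.union_disjoint[symmetric]) (use fin in \<open>auto intro!: sum.cong\<close>)
  \<comment> \<open>Edges have \<open>Suc s\<close> vertices and so are nonempty; counting each edge
    once per vertex therefore loses no weight.\<close>
  have "(\<Sum>F\<in>{F\<in>Pow V. ?U F}. H F) \<le> (\<Sum>F\<in>{F\<in>Pow V. ?U F}. \<Sum>v\<in>V. if v \<in> F then H F else 0)"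
  proof (rule sum_mono)
    fix F assume F: "F \<in> {F\<in>Pow V. ?U F}"
    show "H F \<le> (\<Sum>v\<in>V. if v \<in> F then H F else 0)"
    proof (cases "H F = 0")
      case False
      then have "card F = Suc s" using H unfolding uniform_weight_def by auto
      then obtain v where v: "v \<in> F" by fastforce
      then have "v \<in> V" using F by auto
      have "H F = (\<Sum>v\<in>{v}. if v \<in> F then H F else 0)" using v by simp
      also have "\<dots> \<le> (\<Sum>v\<in>V. if v \<in> F then H F else 0)"
        using \<open>v \<in> V\<close> fin Hnn by (intro sum_mono2) auto
      finally show ?thesis .
    qed (simp add: sum_nonneg)
  qed
  also have "\<dots> = (\<Sum>v\<in>V. \<Sum>F\<in>{F\<in>Pow V. ?U F}. if v \<in> F then H F else 0)"
    by (rule sum.swap)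
  also have "\<dots> \<le> (\<Sum>v\<in>V. link_gain V ?U H v)"
  proof (rule sum_mono)
    fix v
    have "(\<Sum>F\<in>{F\<in>Pow V. ?U F}. if v \<in> F then H F else 0) = (\<Sum>F\<in>{F\<in>{F\<in>Pow V. ?U F}. v \<in> F}. H F)"
      using fin by (subst sum.inter_filter) auto
    also have "\<dots> \<le> link_gain V ?U H v"
      unfolding link_gain_def
    proof (rule sum_mono2)
      show "{F \<in> {F \<in> Pow V. ?U F}. v \<in> F} \<subseteq> {F \<in> Pow V. v \<in> F \<and> ?U (F - {v})}"
        using unsaturated_mono[of V q _ G _ "_ - {v}"] by auto
    qed (use fin Hnn in auto)
    finally show "(\<Sum>F\<in>{F\<in>Pow V. ?U F}. if v \<in> F then H F else 0) \<le> link_gain V ?U H v" .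
  qed
  also have "\<dots> = (\<Sum>v\<in>V - C. link_gain V ?U H v) + (\<Sum>v\<in>C. link_gain V ?U H v)"
    by (rule sum.subset_diff[OF CV fin])
  also have "(\<Sum>v\<in>C. link_gain V ?U H v) \<le> (\<Sum>v\<in>C. c / 4 * q v)"
    using C by (intro sum_mono) auto
  also have "\<dots> \<le> (\<Sum>v\<in>V. c / 4 * q v)"
    using CV fin q c by (intro sum_mono2) (auto intro: less_imp_le)
  also have "\<dots> = c / 4 * ?Q" by (simp add: sum_distrib_left)
  also have "(\<Sum>v\<in>V - C. link_gain V ?U H v) \<le> (\<Sum>v\<in>V - C. K * q v)"
  proof (rule sum_mono)
    fix v assume v: "v \<in> V - C"
    have "link_gain V ?U H v \<le> codegree V H {v}"
      unfolding link_gain_def codegree_def using fin Hnn by (intro sum_mono2) auto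
    also have "\<dots> \<le> K * prod q {v}" using H(2) v unfolding bounded_weight_def by blast
    finally show "link_gain V ?U H v \<le> K * q v" by simp
  qed
  also have "\<dots> = K * sum q (V - C)" by (simp add: sum_distrib_left)
  finally have "(\<Sum>F\<in>{F\<in>Pow V. ?U F}. H F) \<le> K * sum q (V - C) + c / 4 * ?Q" by simp
  then have "c * ?Q \<le> K * sum q (V - C) + c / 4 * ?Q + c / 4 * ?Q"
    using split sat WH by linarith
  moreover have "c * ?Q \<ge> 0" using c q by (simp add: sum_nonneg less_imp_le)
  ultimately have "c * ?Q / 4 \<le> K * sum q (V - C)" by linarith
  then show ?thesis using \<open>K > 0\<close> by (simp add: field_simps)
qed

section \<open>Container families and the decision tree\<close>

text \<open>The property \<open>P\<close> is a parameter so that a branch of the decision tree only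
  has to cover the sets \<open>I\<close> that reach it. The size of a container is controlled
  through the weight that it omits.\<close>

definition has_containers ::
    "'b set \<Rightarrow> ('b \<Rightarrow> real) \<Rightarrow> real \<Rightarrow> nat \<Rightarrow> ('b set \<Rightarrow> bool) \<Rightarrow> bool" where
  "has_containers V q \<delta> N P \<longleftrightarrow>
     (\<exists>\<C>. \<C> \<subseteq> Pow V \<and> card \<C> \<le> N \<and> (\<forall>C\<in>\<C>. \<delta> * sum q V \<le> sum q (V - C)) \<and>
          (\<forall>I. I \<subseteq> V \<longrightarrow> P I \<longrightarrow> (\<exists>C\<in>\<C>. I \<subseteq> C)))"

lemma has_containersI:
  assumes "\<C> \<subseteq> Pow V" "card \<C> \<le> N" "\<And>C. C \<in> \<C> \<Longrightarrow> \<delta> * sum q V \<le> sum q (V - C)"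
    "\<And>I. I \<subseteq> V \<Longrightarrow> P I \<Longrightarrow> \<exists>C\<in>\<C>. I \<subseteq> C"
  shows "has_containers V q \<delta> N P"
  unfolding has_containers_def using assms by (intro exI[of _ \<C>]) auto

lemma has_containersE:
  assumes "has_containers V q \<delta> N P"
  obtains \<C> where "\<C> \<subseteq> Pow V" "card \<C> \<le> N" "\<And>C. C \<in> \<C> \<Longrightarrow> \<delta> * sum q V \<le> sum q (V - C)"
    "\<And>I. I \<subseteq> V \<Longrightarrow> P I \<Longrightarrow> \<exists>C\<in>\<C>. I \<subseteq> C"
proof -
  from assms obtain \<C> where "\<C> \<subseteq> Pow V \<and> card \<C> \<le> N \<and> (\<forall>C\<in>\<C>. \<delta> * sum q V \<le> sum q (V - C)) \<and>
      (\<forall>I. I \<subseteq> V \<longrightarrow> P I \<longrightarrow> (\<exists>C\<in>\<C>. I \<subseteq> C))"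
    unfolding has_containers_def by (rule exE)
  then show thesis by (intro that[of \<C>]) auto
qed

lemma has_containers_mono:
  assumes "has_containers V q \<delta> N P" "N \<le> N'" "\<And>I. P' I \<Longrightarrow> P I"
  shows "has_containers V q \<delta> N' P'"
  by (rule has_containersE[OF assms(1)], rule has_containersI) (use assms(2,3) in auto)

text \<open>One node of the decision tree: a set \<open>I\<close> either lies in \<open>C\<close>,
  or contains some \<open>v\<close> outside \<open>C\<close> and is handled by the family belonging
  to \<open>v\<close>.\<close>

lemma has_containers_branch:
  assumes fin: "finite V" and C: "C \<subseteq> V" "\<delta> * sum q V \<le> sum q (V - C)" and N: "N \<ge> 1"
    and branch: "\<And>v. v \<in> V - C \<Longrightarrow> has_containers V q \<delta> N (\<lambda>I. P I \<and> v \<in> I)"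
  shows "has_containers V q \<delta> ((card V + 1) * N) P"
proof -
  have "\<exists>\<C>. \<C> \<subseteq> Pow V \<and> card \<C> \<le> N \<and> (\<forall>C\<in>\<C>. \<delta> * sum q V \<le> sum q (V - C)) \<and>
      (\<forall>I. I \<subseteq> V \<longrightarrow> P I \<and> v \<in> I \<longrightarrow> (\<exists>C\<in>\<C>. I \<subseteq> C))" if "v \<in> V - C" for v
    using branch[OF that] unfolding has_containers_def .
  then obtain f where "\<forall>v\<in>V - C. f v \<subseteq> Pow V \<and> card (f v) \<le> N \<and>
      (\<forall>C\<in>f v. \<delta> * sum q V \<le> sum q (V - C)) \<and>
      (\<forall>I. I \<subseteq> V \<longrightarrow> P I \<and> v \<in> I \<longrightarrow> (\<exists>C\<in>f v. I \<subseteq> C))"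
    by metis
  then have f: "\<And>v. v \<in> V - C \<Longrightarrow> f v \<subseteq> Pow V" "\<And>v. v \<in> V - C \<Longrightarrow> card (f v) \<le> N"
      "\<And>v D. v \<in> V - C \<Longrightarrow> D \<in> f v \<Longrightarrow> \<delta> * sum q V \<le> sum q (V - D)"
      "\<And>v I. v \<in> V - C \<Longrightarrow> I \<subseteq> V \<Longrightarrow> P I \<Longrightarrow> v \<in> I \<Longrightarrow> \<exists>D\<in>f v. I \<subseteq> D"
    by simp_all
  show ?thesis
  proof (rule has_containersI[where \<C> = "insert C (\<Union>v\<in>V - C. f v)"])
    have "card (\<Union>v\<in>V - C. f v) \<le> (\<Sum>v\<in>V - C. card (f v))"
      using fin by (intro card_UN_le) auto
    also have "\<dots> \<le> (\<Sum>v\<in>V - C. N)"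
      using f by (intro sum_mono) auto
    also have "\<dots> \<le> card V * N"
      using fin by (simp add: card_mono)
    finally have "card (insert C (\<Union>v\<in>V - C. f v)) \<le> 1 + card V * N"
      using card_insert_le_m1[of "1 + card V * N" "\<Union>v\<in>V - C. f v" C] by simp
    \<comment> \<open>The extra container \<open>C\<close> is absorbed because \<open>N\<close> is
      at least 1.\<close>
    then show "card (insert C (\<Union>v\<in>V - C. f v)) \<le> (card V + 1) * N"
      using N by simp
    show "insert C (\<Union>v\<in>V - C. f v) \<subseteq> Pow V" using C(1) f(1) by fast
    show "\<delta> * sum q V \<le> sum q (V - D)" if "D \<in> insert C (\<Union>v\<in>V - C. f v)" for D
      using that f(3) C(2) by auto
    show "\<exists>D\<in>insert C (\<Union>v\<in>V - C. f v). I \<subseteq> D" if I: "I \<subseteq> V" "P I" for I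
    proof (cases "I \<subseteq> C")
      case False
      then obtain v where v: "v \<in> I" "v \<in> V - C" using I by auto
      from f(4)[OF v(2) I v(1)] v(2) show ?thesis by auto
    qed auto
  qed
qed

text \<open>The family is the set of leaves of a decision tree: as long as the link hypergraph \<open>G\<close> is
  light, either an independent set avoids all vertices of large gain, or branching over such a
  vertex in it increases the weight of \<open>G\<close> by \<open>c / 4\<close>.\<close>

lemma container_step:
  fixes V :: "'b set"
  assumes fin: "finite V" and q: "\<And>x. x \<in> V \<Longrightarrow> q x > 0"
    and H: "uniform_weight V (Suc s) H" "bounded_weight V q K H" and K: "K > 0"
    and c: "c > 0" and WH: "c * sum q V \<le> sum H (Pow V)" and sk: "s \<le> k"
    and K': "K' = (1 + 4 * 2 ^ k) * K" and \<delta>: "\<delta> \<le> c / (4 * K)" and R: "R \<ge> 1"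
    and IH: "\<And>G. uniform_weight V s G \<Longrightarrow> bounded_weight V q K' G \<Longrightarrow> c * sum q V \<le> sum G (Pow V) \<Longrightarrow>
       has_containers V q \<delta> R (independent_in G)"
  shows "uniform_weight V s G \<Longrightarrow> bounded_weight V q K' G \<Longrightarrow>
     c * sum q V \<le> sum G (Pow V) + real t * (c / 4) \<Longrightarrow>
     has_containers V q \<delta> ((card V + 1) ^ t * R) (\<lambda>I. independent_in H I \<and> independent_in G I)"
proof (induction t arbitrary: G)
  case 0
  \<comment> \<open>With no branchings left, the weight hypothesis itself says that \<open>G\<close>
    is heavy.\<close>
  then have "c * sum q V \<le> sum G (Pow V)" by simp
  from IH[OF 0(1,2) this] show ?case by (rule has_containers_mono) auto
next
  case (Suc t)
  show ?case
  proof (cases "c * sum q V \<le> sum G (Pow V)")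
    case True
    have "1 * R \<le> (card V + 1) ^ Suc t * R"
      by (rule mult_le_mono[OF one_le_power]) auto
    then show ?thesis by (intro has_containers_mono[OF IH[OF Suc.prems(1,2) True]]) auto
  next
    case False
    define U where "U = unsaturated V q (K' - K) G"
    define C where "C = {v\<in>V. link_gain V U H v < c / 4 * q v}"
    \<comment> \<open>This is the purpose of the value of \<open>K'\<close>: saturation starts at
      \<open>4 * 2 ^ k * K\<close>, as the estimate of low-gain vertices requires, and
      \<open>K\<close> is left as slack for one more link.\<close>
    have KK: "K' - K = 4 * 2 ^ k * K" unfolding K' by (simp add: algebra_simps)
    have Q: "sum q V \<ge> 0" using q by (simp add: sum_nonneg less_imp_le)
    have "c / (4 * K) * sum q V \<le> sum q (V - C)"
      by (rule low_gain_set[OF fin q H K Suc.prems(1) c WH _ _ sk])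
         (use False in \<open>auto simp: C_def U_def KK\<close>)
    then have C: "\<delta> * sum q V \<le> sum q (V - C)"
      using mult_right_mono[OF \<delta> Q] by linarith
    have "has_containers V q \<delta> ((card V + 1) * ((card V + 1) ^ t * R))
        (\<lambda>I. independent_in H I \<and> independent_in G I)"
    proof (rule has_containers_branch[OF fin _ C])
      fix v assume v: "v \<in> V - C"
      have qv: "q v > 0" using q v by auto
      have "has_containers V q \<delta> ((card V + 1) ^ t * R)
          (\<lambda>I. independent_in H I \<and> independent_in (add_link q U H v G) I)"
      proof (rule Suc.IH)
        show "uniform_weight V s (add_link q U H v G)"
          using fin H(1) Suc.prems(1) qv by (rule uniform_weight_add_link)
        show "bounded_weight V q K' (add_link q U H v G)"
          unfolding U_def using v by (intro bounded_weight_add_link[OF fin _ q H Suc.prems(2)]) auto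
        \<comment> \<open>After division by \<open>q v\<close> the gain is at least
          \<open>c / 4\<close>, whatever \<open>v\<close> is. This pays for the drop from
          \<open>Suc t\<close> to \<open>t\<close>.\<close>
        have "c / 4 \<le> link_gain V U H v / q v"
          using v qv unfolding C_def by (auto simp: field_simps)
        moreover have "real (Suc t) * (c / 4) = real t * (c / 4) + c / 4" by (simp add: algebra_simps)
        moreover have "sum (add_link q U H v G) (Pow V) = sum G (Pow V) + link_gain V U H v / q v"
          using v by (intro sum_add_link[OF fin]) auto
        ultimately show "c * sum q V \<le> sum (add_link q U H v G) (Pow V) + real t * (c / 4)"
          using Suc.prems(3) by linarith
      qed
      then show "has_containers V q \<delta> ((card V + 1) ^ t * R)
          (\<lambda>I. (independent_in H I \<and> independent_in G I) \<and> v \<in> I)"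
        by (rule has_containers_mono) (simp_all add: independent_in_add_link)
    next
      have "1 * 1 \<le> (card V + 1) ^ t * R"
        by (rule mult_le_mono[OF one_le_power R]) simp
      then show "1 \<le> (card V + 1) ^ t * R" by simp
    qed (auto simp: C_def)
    then show ?thesis by (simp only: power_Suc mult.assoc)
  qed
qed

text \<open>Induction on the uniformity \<open>s\<close>. Passing to links multiplies
  \<open>K\<close> by \<open>1 + 4 * 2 ^ k\<close> and keeps \<open>c\<close>; the fixed
  \<open>k\<close> makes this factor the same on every level. Each level is a tree of depth
  \<open>t\<close> with at most \<open>card V + 1\<close> children per node, hence the exponent
  \<open>s * t\<close>.\<close>

lemma weighted_containers:
  fixes V :: "'b set"
  assumes fin: "finite V" and q: "\<And>x. x \<in> V \<Longrightarrow> q x > 0" and Q: "sum q V > 0" and c: "c > 0"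
    and t: "4 * sum q V \<le> real t"
  shows "s \<le> k \<Longrightarrow> uniform_weight V s H \<Longrightarrow> bounded_weight V q K H \<Longrightarrow> K > 0 \<Longrightarrow>
     c * sum q V \<le> sum H (Pow V) \<Longrightarrow>
     has_containers V q (c / (4 * K * (1 + 4 * 2 ^ k) ^ s)) ((card V + 1) ^ (s * t)) (independent_in H)"
proof (induction s arbitrary: H K)
  case 0
  \<comment> \<open>At uniformity 0 the positive weight sits on the empty set, which is contained in
    every \<open>I\<close>. No set is independent, so the empty family suffices.\<close>
  have "c * sum q V > 0" using Q c by simp
  then have "sum H (Pow V) \<noteq> 0" using 0 by linarith
  then obtain F where "F \<in> Pow V" "H F \<noteq> 0" by (meson sum.neutral)
  then have "H {} \<noteq> 0"
    using 0 fin finite_subset[of F V] unfolding uniform_weight_def by (metis PowD card_0_eq)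
  then have "\<not> independent_in H I" for I
    unfolding independent_in_def by auto
  then show ?case by (intro has_containersI[where \<C> = "{}"]) auto
next
  case (Suc s)
  define A :: real where "A = 1 + 4 * 2 ^ k"
  have A: "A \<ge> 1" unfolding A_def by simp
  have eq: "4 * (A * K) * A ^ s = 4 * K * A ^ Suc s" by (simp add: algebra_simps)
  have AK: "A * K > 0" using Suc.prems(4) A by (intro mult_pos_pos) auto
  have "0 \<le> A * K * prod q S" if "S \<subseteq> V" for S
    using that q by (intro mult_nonneg_nonneg[OF less_imp_le[OF AK]] prod_nonneg) (auto intro: less_imp_le)
  then have zero: "uniform_weight V s (\<lambda>_. 0)" "bounded_weight V q (A * K) (\<lambda>_. 0)"
    unfolding uniform_weight_def bounded_weight_def codegree_def by auto
  \<comment> \<open>The tree starts from \<open>G = 0\<close>, for which independence holds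
    trivially.\<close>
  have "has_containers V q (c / (4 * K * A ^ Suc s)) ((card V + 1) ^ t * (card V + 1) ^ (s * t))
     (\<lambda>I. independent_in H I \<and> independent_in (\<lambda>_. 0) I)"
  proof (rule container_step[OF fin q Suc.prems(2,3,4) c Suc.prems(5), where k = k])
    show "c / (4 * K * A ^ Suc s) \<le> c / (4 * K)"
    proof -
      have "4 * K * 1 \<le> 4 * K * A ^ Suc s"
        using Suc.prems(4) one_le_power[OF A, of "Suc s"] by (intro mult_left_mono) auto
      moreover have "0 < 4 * K * A ^ Suc s"
        using Suc.prems(4) A by (intro mult_pos_pos zero_less_power) auto
      ultimately show ?thesis
        using c Suc.prems(4) by (intro divide_left_mono mult_pos_pos) auto
    qed
    show "has_containers V q (c / (4 * K * A ^ Suc s)) ((card V + 1) ^ (s * t)) (independent_in G)"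
      if "uniform_weight V s G" "bounded_weight V q (A * K) G" "c * sum q V \<le> sum G (Pow V)" for G
      using Suc.IH[OF _ that(1,2) AK that(3)] Suc.prems(1) unfolding A_def[symmetric] eq by simp
    \<comment> \<open>Raising the weight from 0 to \<open>c * sum q V\<close> in steps of
      \<open>c / 4\<close> takes \<open>4 * sum q V\<close> steps.\<close>
    have "c / 4 * (4 * sum q V) \<le> c / 4 * real t"
      using c t by (intro mult_left_mono) auto
    then show "c * sum q V \<le> sum (\<lambda>_. 0) (Pow V) + real t * (c / 4)" by (simp add: mult.commute)
  qed (use zero Suc.prems in \<open>auto simp: A_def\<close>)
  moreover have "(card V + 1) ^ t * (card V + 1) ^ (s * t) = (card V + 1) ^ (Suc s * t)"
    by (simp add: power_add)
  ultimately show ?case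
    unfolding A_def[symmetric] by (elim has_containers_mono) (auto simp: independent_in_def)
qed

section \<open>Containers for unweighted hypergraphs\<close>

text \<open>Vertices are weighted by \<open>\<tau> (\<delta> / 2 + deg v / d)\<close>, with \<open>d\<close> the average degree up to the
  factor \<open>k\<close>. Hence no bound on the maximum degree is needed, and a container missing a fixed
  proportion of the weight also misses a fixed proportion of the edges.\<close>

lemma unweighted_containers:
  fixes X :: "'b set" and \<H> :: "'b set set" and N \<tau> \<delta> :: real
  assumes fin: "finite X" and \<H>: "\<H> \<subseteq> [X]\<^bsup>k\<^esup>" "\<H> \<noteq> {}" and k: "k \<ge> 1"
    and N: "real (card X) \<le> N" "N > 0" and \<tau>: "\<tau> > 0"
    and \<delta>_def: "\<delta> = 1 / (4 * (real k + 1) * (1 + 4 * 2 ^ k) ^ k)"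
    and codeg: "\<And>S. S \<subseteq> X \<Longrightarrow> card S \<ge> 2 \<Longrightarrow>
       real (card {A\<in>\<H>. S \<subseteq> A}) \<le> \<tau> ^ (card S - 1) * (\<delta> / 2) ^ card S * (real (card \<H>) / N)"
    and t: "4 * \<tau> * (real k + 1) * N \<le> real t"
  shows "\<exists>\<C>. \<C> \<subseteq> Pow X \<and> card \<C> \<le> (card X + 1) ^ (k * t) \<and>
     (\<forall>D\<in>\<C>. real (card {A\<in>\<H>. A \<subseteq> D}) \<le> (1 - \<delta> / (2 * real k)) * real (card \<H>)) \<and>
     (\<forall>I. I \<subseteq> X \<longrightarrow> (\<forall>A\<in>\<H>. \<not> A \<subseteq> I) \<longrightarrow> (\<exists>D\<in>\<C>. I \<subseteq> D))"
proof -
  have A1: "(1 + 4 * 2 ^ k :: real) ^ k \<ge> 1" by (intro one_le_power) simp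
  then have "4 * (real k + 1) * (1 + 4 * 2 ^ k) ^ k \<ge> 4 * (real k + 1) * 1"
    by (intro mult_left_mono) auto
  moreover have "4 * (real k + 1) * 1 \<ge> 1" by simp
  ultimately have den: "4 * (real k + 1) * (1 + 4 * 2 ^ k) ^ k \<ge> 1" by (rule order_trans[rotated])
  have \<delta>: "0 < \<delta>" "\<delta> \<le> 1" unfolding \<delta>_def using den by (auto simp: divide_le_eq_1 simp del: power_Suc)
  \<comment> \<open>Only half of \<open>\<delta>\<close> goes into the constant part of
    \<open>q\<close>, so that the weight missing from a container cannot come from this part
    alone.\<close>
  define \<eta> where "\<eta> = \<delta> / 2"
  have \<eta>: "0 < \<eta>" "\<eta> \<le> 1" using \<delta> unfolding \<eta>_def by auto
  have fin\<H>: "finite \<H>" using \<H>(1) fin finite_imp_finite_nsets finite_subset by blast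
  have \<H>X: "A \<subseteq> X" "card A = k" "finite A" if "A \<in> \<H>" for A
    using that \<H>(1) unfolding nsets_def by auto
  have e: "real (card \<H>) > 0" using fin\<H> \<H>(2) by (simp add: card_gt_0_iff)
  define d where "d = real (card \<H>) / N"
  have d: "d > 0" and ed: "real (card \<H>) = d * N" unfolding d_def using e N by auto
  define deg where "deg v = real (card {A\<in>\<H>. v \<in> A})" for v
  define q where "q v = \<tau> * (\<eta> + deg v / d)" for v
  \<comment> \<open>With this scaling the codegree of \<open>{v}\<close> is
    \<open>\<tau> / d * deg v\<close>, the degree part of \<open>q v\<close>, so
    \<open>K = 1\<close> will do.\<close>
  define H where "H A = (if A \<in> \<H> then \<tau> / d else 0)" for A
  have q_ge: "q v \<ge> \<tau> * \<eta>" "q v \<ge> \<tau> / d * deg v" for v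
    unfolding q_def deg_def using \<tau> d \<eta> by (auto simp: algebra_simps)
  have qpos: "q v > 0" for v using q_ge(1)[of v] \<tau> \<eta> mult_pos_pos[of \<tau> \<eta>] by linarith
  have sumdeg: "(\<Sum>v\<in>Y. deg v) = (\<Sum>A\<in>\<H>. real (card (A \<inter> Y)))" if "Y \<subseteq> X" for Y
  proof -
    have finY: "finite Y" using that fin finite_subset by auto
    have "(\<Sum>v\<in>Y. deg v) = (\<Sum>v\<in>Y. \<Sum>A\<in>\<H>. if v \<in> A then 1 else 0)"
    proof (rule sum.cong[OF refl])
      fix v
      have "deg v = (\<Sum>A\<in>{A\<in>\<H>. v \<in> A}. 1)" unfolding deg_def by simp
      also have "\<dots> = (\<Sum>A\<in>\<H>. if v \<in> A then 1 else 0)" by (rule sum.inter_filter[OF fin\<H>])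
      finally show "deg v = (\<Sum>A\<in>\<H>. if v \<in> A then 1 else 0)" .
    qed
    also have "\<dots> = (\<Sum>A\<in>\<H>. \<Sum>v\<in>Y. if v \<in> A then 1 else 0)" by (rule sum.swap)
    also have "\<dots> = (\<Sum>A\<in>\<H>. real (card (A \<inter> Y)))"
    proof (rule sum.cong[OF refl])
      fix A
      have "(\<Sum>v\<in>Y. if v \<in> A then 1 else 0) = (\<Sum>v\<in>{v\<in>Y. v \<in> A}. 1::real)"
        by (rule sum.inter_filter[OF finY, symmetric])
      also have "{v\<in>Y. v \<in> A} = A \<inter> Y" by auto
      finally show "(\<Sum>v\<in>Y. if v \<in> A then 1 else 0) = real (card (A \<inter> Y))" by simp
    qed
    finally show ?thesis .
  qed
  have sumq: "sum q Y = \<tau> * (\<eta> * real (card Y) + (\<Sum>v\<in>Y. deg v) / d)" for Y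
    unfolding q_def by (simp add: sum_distrib_left[symmetric] sum.distrib sum_divide_distrib[symmetric] mult.commute)
  have "(\<Sum>v\<in>X. deg v) = (\<Sum>A\<in>\<H>. real k)"
    unfolding sumdeg[OF subset_refl] by (rule sum.cong[OF refl]) (use \<H>X in \<open>auto simp: Int_absorb2\<close>)
  then have sdX: "(\<Sum>v\<in>X. deg v) = real k * (d * N)" using ed by simp
  have Q: "sum q X = \<tau> * (\<eta> * real (card X) + real k * N)"
    unfolding sumq sdX using d by simp
  have "\<eta> * real (card X) \<le> 1 * N" using \<eta> N by (intro mult_mono) auto
  then have Qle: "sum q X \<le> \<tau> * ((real k + 1) * N)"
    unfolding Q using \<tau> by (intro mult_left_mono) (auto simp: algebra_simps)
  have Qge: "sum q X \<ge> \<tau> * N"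
  proof -
    have "1 * N \<le> real k * N" using k N by (intro mult_right_mono) auto
    moreover have "0 \<le> \<eta> * real (card X)" using \<eta> by simp
    ultimately show ?thesis unfolding Q using \<tau> by (intro mult_left_mono) auto
  qed
  have codegH: "codegree X H S = \<tau> / d * real (card {A\<in>\<H>. S \<subseteq> A})" for S
  proof -
    have "codegree X H S = (\<Sum>A\<in>{A\<in>\<H>. S \<subseteq> A}. \<tau> / d)"
      unfolding codegree_def
      by (rule sum.mono_neutral_cong_right) (use fin \<H>X in \<open>auto simp: H_def\<close>)
    then show ?thesis by simp
  qed
  have "codegree X H {} = \<tau> * N"
    unfolding codegH using d by (simp add: ed)
  then have W: "sum H (Pow X) = \<tau> * N" unfolding codegree_def by (simp add: Pow_def)
  have unif: "uniform_weight X k H"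
    unfolding uniform_weight_def H_def using \<tau> d \<H>X by auto
  have bdd: "bounded_weight X q 1 H"
    unfolding bounded_weight_def
  proof (intro allI impI)
    fix S assume S: "S \<subseteq> X \<and> S \<noteq> {}"
    then have finS: "finite S" using fin finite_subset by auto
    then have "card S \<ge> 1" using S by (simp add: Suc_le_eq card_gt_0_iff)
    then consider "card S = 1" | "card S \<ge> 2" by linarith
    then show "codegree X H S \<le> 1 * prod q S"
    proof cases
      case 1
      then obtain v where "S = {v}" by (auto simp: card_1_singleton_iff)
      then show ?thesis unfolding codegH using q_ge(2)[of v] by (simp add: deg_def)
    next
      case 2
      \<comment> \<open>From two vertices on, the assumed codegree bound is compared with the
        constant part of \<open>q\<close> alone: every factor of \<open>prod q S\<close> is at least
        \<open>\<tau> * \<eta>\<close>.\<close>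
      have "codegree X H S \<le> \<tau> / d * (\<tau> ^ (card S - 1) * \<eta> ^ card S * d)"
        unfolding codegH using codeg[of S] S 2 \<tau> d unfolding d_def[symmetric] \<eta>_def[symmetric]
        by (intro mult_left_mono) auto
      also have "\<dots> = \<tau> * \<tau> ^ (card S - 1) * \<eta> ^ card S" using d by simp
      also have "\<dots> = (\<tau> * \<eta>) ^ card S"
        using 2 by (simp add: power_mult_distrib power_Suc[symmetric] del: power_Suc)
      also have "\<dots> = (\<Prod>v\<in>S. \<tau> * \<eta>)" by simp
      also have "\<dots> \<le> prod q S" using q_ge \<tau> \<eta> by (intro prod_mono) auto
      finally show ?thesis by simp
    qed
  qed
  have Qpos: "sum q X > 0" using Qge \<tau> N mult_pos_pos[of \<tau> N] by linarith
  \<comment> \<open>Here \<open>K = 1\<close> and \<open>c = 1 / (k + 1)\<close>: the weight of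
    \<open>H\<close> is \<open>\<tau> * N\<close>, while \<open>sum q X\<close> is at most
    \<open>\<tau> * (k + 1) * N\<close>. The proportion obtained is exactly
    \<open>\<delta>\<close>.\<close>
  have "has_containers X q (1 / (real k + 1) / (4 * 1 * (1 + 4 * 2 ^ k) ^ k)) ((card X + 1) ^ (k * t)) (independent_in H)"
  proof (rule weighted_containers[OF fin qpos Qpos _ _ order_refl unif bdd])
    show "4 * sum q X \<le> real t" using Qle t by (simp only: mult.assoc)
    show "1 / (real k + 1) * sum q X \<le> sum H (Pow X)"
      unfolding W using Qle by (simp add: field_simps)
  qed auto
  then have "has_containers X q \<delta> ((card X + 1) ^ (k * t)) (independent_in H)"
    unfolding \<delta>_def by (simp only: divide_divide_eq_left mult_1_right mult.assoc mult.left_commute)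
  then obtain \<C> where \<C>: "\<C> \<subseteq> Pow X" "card \<C> \<le> (card X + 1) ^ (k * t)"
      "\<And>C. C \<in> \<C> \<Longrightarrow> \<delta> * sum q X \<le> sum q (X - C)"
      "\<And>I. I \<subseteq> X \<Longrightarrow> independent_in H I \<Longrightarrow> \<exists>C\<in>\<C>. I \<subseteq> C"
    by (rule has_containersE) (rule that)
  have "real (card {A\<in>\<H>. A \<subseteq> D}) \<le> (1 - \<delta> / (2 * real k)) * real (card \<H>)" if D: "D \<in> \<C>" for D
  proof -
    have "\<delta> * (\<tau> * N) \<le> \<delta> * sum q X" using Qge \<delta> by (intro mult_left_mono) auto
    also have "\<dots> \<le> sum q (X - D)" by (rule \<C>(3)[OF D])
    also have "\<dots> \<le> \<tau> * (\<eta> * N + (\<Sum>v\<in>X - D. deg v) / d)"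
    proof -
      have "real (card (X - D)) \<le> N" using N card_mono[OF fin Diff_subset[of X D]] by linarith
      then show ?thesis unfolding sumq using \<tau> \<eta> by (intro mult_left_mono add_right_mono) auto
    qed
    finally have "\<tau> * (\<delta> * N) \<le> \<tau> * (\<eta> * N + (\<Sum>v\<in>X - D. deg v) / d)" by (simp add: mult.left_commute)
    \<comment> \<open>The constant part explains at most \<open>\<delta> / 2 * N\<close> of the
      missing weight; the remainder must come from degrees.\<close>
    then have "\<delta> * N \<le> \<delta> / 2 * N + (\<Sum>v\<in>X - D. deg v) / d"
      using \<tau> unfolding \<eta>_def by (simp only: mult_le_cancel_left_pos)
    then have "\<delta> / 2 * N * d \<le> (\<Sum>v\<in>X - D. deg v)"
      using d by (simp add: field_simps)
    also have "\<dots> = (\<Sum>A\<in>\<H>. real (card (A \<inter> (X - D))))" by (rule sumdeg) auto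
    \<comment> \<open>Only edges not inside \<open>D\<close> meet the complement of
      \<open>D\<close>, each in at most \<open>k\<close> vertices, so a large degree sum outside
      \<open>D\<close> means many lost edges.\<close>
    also have "\<dots> \<le> (\<Sum>A\<in>\<H>. if \<not> A \<subseteq> D then real k else 0)"
    proof (rule sum_mono)
      fix A assume A: "A \<in> \<H>"
      show "real (card (A \<inter> (X - D))) \<le> (if \<not> A \<subseteq> D then real k else 0)"
      proof (cases "A \<subseteq> D")
        case True
        then have "A \<inter> (X - D) = {}" by auto
        then show ?thesis using True by simp
      next
        case False
        then show ?thesis using card_mono[of A "A \<inter> (X - D)"] \<H>X[OF A] by simp
      qed
    qed
    also have "\<dots> = (\<Sum>A\<in>{A\<in>\<H>. \<not> A \<subseteq> D}. real k)" by (rule sum.inter_filter[OF fin\<H>, symmetric])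
    also have "\<dots> = real k * real (card {A\<in>\<H>. \<not> A \<subseteq> D})" by simp
    finally have *: "\<delta> / 2 * real (card \<H>) \<le> real k * real (card {A\<in>\<H>. \<not> A \<subseteq> D})"
      using ed by (simp add: mult_ac)
    have "card \<H> = card ({A\<in>\<H>. A \<subseteq> D} \<union> {A\<in>\<H>. \<not> A \<subseteq> D})"
      by (rule arg_cong[of _ _ card]) auto
    also have "\<dots> = card {A\<in>\<H>. A \<subseteq> D} + card {A\<in>\<H>. \<not> A \<subseteq> D}"
      using fin\<H> by (intro card_Un_disjoint) auto
    finally show ?thesis using * k by (simp add: field_simps)
  qed
  moreover have "independent_in H I" if "\<forall>A\<in>\<H>. \<not> A \<subseteq> I" for I
    unfolding independent_in_def H_def using that by auto
  ultimately show ?thesis using \<C> by (intro exI[of _ \<C>]) auto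
qed

section \<open>Iterating the container step\<close>

text \<open>Every set with \<open>f\<close> above \<open>T\<close> is replaced by containers on
  which \<open>f\<close> shrinks by the factor \<open>1 - \<delta>\<close>; a set already at most
  \<open>T\<close> is its own container. After \<open>i\<close> rounds all values are at most
  \<open>T\<close>, and each round multiplies the count by at most \<open>R\<close>.\<close>

lemma iterated_containers:
  fixes f :: "'b set \<Rightarrow> real"
  assumes \<delta>: "0 \<le> \<delta>" "\<delta> \<le> 1" and R: "R \<ge> 1" and fin: "finite X"
    and step: "\<And>C. C \<subseteq> X \<Longrightarrow> f C > T \<Longrightarrow>
      \<exists>\<C>. \<C> \<subseteq> Pow C \<and> card \<C> \<le> R \<and> (\<forall>D\<in>\<C>. f D \<le> (1 - \<delta>) * f C) \<and>
         (\<forall>I. I \<subseteq> C \<longrightarrow> P I \<longrightarrow> (\<exists>D\<in>\<C>. I \<subseteq> D))"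
  shows "C \<subseteq> X \<Longrightarrow> (1 - \<delta>) ^ i * f C \<le> T \<Longrightarrow>
      \<exists>\<C>. \<C> \<subseteq> Pow C \<and> card \<C> \<le> R ^ i \<and> (\<forall>D\<in>\<C>. f D \<le> T) \<and>
         (\<forall>I. I \<subseteq> C \<longrightarrow> P I \<longrightarrow> (\<exists>D\<in>\<C>. I \<subseteq> D))"
proof (induction i arbitrary: C)
  case 0
  then show ?case by (intro exI[of _ "{C}"]) auto
next
  case (Suc i)
  show ?case
  proof (cases "f C > T")
    case False
    have "1 \<le> R ^ Suc i" using R by (rule one_le_power)
    then show ?thesis using False by (intro exI[of _ "{C}"]) auto
  next
    case True
    from step[OF Suc.prems(1) True] obtain \<D> where \<D>: "\<D> \<subseteq> Pow C" "card \<D> \<le> R"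
      "\<And>D. D \<in> \<D> \<Longrightarrow> f D \<le> (1 - \<delta>) * f C" "\<And>I. I \<subseteq> C \<Longrightarrow> P I \<Longrightarrow> \<exists>D\<in>\<D>. I \<subseteq> D"
      by auto
    have "\<exists>\<C>. \<C> \<subseteq> Pow D \<and> card \<C> \<le> R ^ i \<and> (\<forall>D\<in>\<C>. f D \<le> T) \<and>
         (\<forall>I. I \<subseteq> D \<longrightarrow> P I \<longrightarrow> (\<exists>D\<in>\<C>. I \<subseteq> D))" if D: "D \<in> \<D>" for D
    proof (rule Suc.IH)
      show "D \<subseteq> X" using D \<D>(1) Suc.prems(1) by auto
      have "(1 - \<delta>) ^ i * f D \<le> (1 - \<delta>) ^ i * ((1 - \<delta>) * f C)"
        using \<D>(3)[OF D] \<delta> by (intro mult_left_mono) auto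
      then show "(1 - \<delta>) ^ i * f D \<le> T" using Suc.prems(2) by (simp add: algebra_simps)
    qed
    then obtain g where "\<forall>D\<in>\<D>. g D \<subseteq> Pow D \<and> card (g D) \<le> R ^ i \<and> (\<forall>D\<in>g D. f D \<le> T) \<and>
         (\<forall>I. I \<subseteq> D \<longrightarrow> P I \<longrightarrow> (\<exists>E\<in>g D. I \<subseteq> E))" by metis
    then have g: "\<And>D. D \<in> \<D> \<Longrightarrow> g D \<subseteq> Pow D" "\<And>D. D \<in> \<D> \<Longrightarrow> card (g D) \<le> R ^ i"
      "\<And>D E. D \<in> \<D> \<Longrightarrow> E \<in> g D \<Longrightarrow> f E \<le> T"
      "\<And>D I. D \<in> \<D> \<Longrightarrow> I \<subseteq> D \<Longrightarrow> P I \<Longrightarrow> \<exists>E\<in>g D. I \<subseteq> E"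
      by simp_all
    have fin\<D>: "finite \<D>" using \<D>(1) Suc.prems(1) fin by (meson finite_Pow_iff finite_subset)
    have "card (\<Union>D\<in>\<D>. g D) \<le> (\<Sum>D\<in>\<D>. card (g D))" using fin\<D> by (rule card_UN_le)
    also have "\<dots> \<le> (\<Sum>D\<in>\<D>. R ^ i)" using g(2) by (rule sum_mono)
    also have "\<dots> \<le> R * R ^ i" using \<D>(2) by simp
    finally have "card (\<Union>D\<in>\<D>. g D) \<le> R ^ Suc i" by simp
    moreover have "(\<Union>D\<in>\<D>. g D) \<subseteq> Pow C" using \<D>(1) g(1) by fast
    moreover have "\<forall>E\<in>(\<Union>D\<in>\<D>. g D). f E \<le> T" using g(3) by blast
    moreover have "\<forall>I. I \<subseteq> C \<longrightarrow> P I \<longrightarrow> (\<exists>E\<in>(\<Union>D\<in>\<D>. g D). I \<subseteq> E)"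
    proof (intro allI impI)
      fix I assume I: "I \<subseteq> C" "P I"
      from \<D>(4)[OF I] obtain D where D: "D \<in> \<D>" "I \<subseteq> D" by (rule bexE)
      from g(4)[OF D I(2)] D(1) show "\<exists>E\<in>(\<Union>D\<in>\<D>. g D). I \<subseteq> E" by auto
    qed
    ultimately show ?thesis by (intro exI[of _ "\<Union>D\<in>\<D>. g D"] conjI)
  qed
qed

section \<open>Rainbow copies of K4 as a 6-uniform hypergraph\<close>

lemma card_nsets_eq:
  assumes "finite A"
  shows "card ([A]\<^bsup>k\<^esup>) = card A choose k"
proof -
  have "[A]\<^bsup>k\<^esup> = {B. B \<subseteq> A \<and> card B = k}"
    unfolding nsets_def using assms finite_subset by auto
  then show ?thesis using n_subsets[OF assms] by simp
qed

abbreviation all_rainbow_K4s :: "nat \<Rightarrow> 'a set \<Rightarrow> 'a set set \<Rightarrow> ('a set \<times> nat) set set" where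
  "all_rainbow_K4s r V E \<equiv> rainbow_K4_copies V E (\<lambda>_. {1..r})"

text \<open>The dictionary between the two settings: a set \<open>C\<close> of pairs (edge, color)
  is read as the template listing at \<open>e\<close> the colors paired with \<open>e\<close>, and
  its rainbow copies are the hyperedges inside \<open>C\<close>.\<close>

lemma rainbow_K4_copies_restrict:
  assumes "C \<subseteq> E \<times> {1..r}"
  shows "rainbow_K4_copies V E (\<lambda>e\<in>E. C `` {e}) = {A\<in>all_rainbow_K4s r V E. A \<subseteq> C}"
proof -
  have E: "F \<subseteq> E" if "F \<in> K4_copies V E" for F using that unfolding K4_copies_def by auto
  show ?thesis
  proof (intro set_eqI iffI)
    fix A assume "A \<in> rainbow_K4_copies V E (\<lambda>e\<in>E. C `` {e})"
    then obtain F c where F: "F \<in> K4_copies V E" "inj_on c F" "A = (\<lambda>e. (e, c e)) ` F"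
      and c: "\<And>e. e \<in> F \<Longrightarrow> c e \<in> (\<lambda>e\<in>E. C `` {e}) e"
      unfolding rainbow_K4_copies_def by blast
    have "(e, c e) \<in> C" if "e \<in> F" for e using c[OF that] E[OF F(1)] that by auto
    then have "A \<subseteq> C" "\<forall>e\<in>F. c e \<in> {1..r}" using F(3) assms by blast+
    then show "A \<in> {A\<in>all_rainbow_K4s r V E. A \<subseteq> C}"
      unfolding rainbow_K4_copies_def using F by blast
  next
    fix A assume A: "A \<in> {A\<in>all_rainbow_K4s r V E. A \<subseteq> C}"
    then obtain F c where F: "F \<in> K4_copies V E" "inj_on c F" "A = (\<lambda>e. (e, c e)) ` F"
      unfolding rainbow_K4_copies_def by blast
    have "\<forall>e\<in>F. c e \<in> (\<lambda>e\<in>E. C `` {e}) e" using A F(3) E[OF F(1)] by auto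
    then show "A \<in> rainbow_K4_copies V E (\<lambda>e\<in>E. C `` {e})"
      unfolding rainbow_K4_copies_def using F by blast
  qed
qed

lemma rainbow_K4E:
  assumes "A \<in> rainbow_K4_copies V E L"
  obtains K c where "K \<in> [V]\<^bsup>4\<^esup>" "[K]\<^bsup>2\<^esup> \<subseteq> E" "A = (\<lambda>e. (e, c e)) ` [K]\<^bsup>2\<^esup>" "\<And>e. e \<in> [K]\<^bsup>2\<^esup> \<Longrightarrow> c e \<in> L e"
  using assms unfolding rainbow_K4_copies_def K4_copies_def by auto

lemma Union_nsets_2:
  assumes "card K \<ge> 2"
  shows "\<Union>([K]\<^bsup>2\<^esup>) = K"
proof
  show "\<Union>([K]\<^bsup>2\<^esup>) \<subseteq> K" unfolding nsets_def by auto
  show "K \<subseteq> \<Union>([K]\<^bsup>2\<^esup>)"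
  proof
    fix x assume x: "x \<in> K"
    have "\<not> K \<subseteq> {x}" using assms card_mono[of "{x}" K] by auto
    then obtain y where "y \<in> K" "y \<noteq> x" by auto
    then have "{x, y} \<in> [K]\<^bsup>2\<^esup>" using x unfolding nsets_def by auto
    then show "x \<in> \<Union>([K]\<^bsup>2\<^esup>)" by blast
  qed
qed

text \<open>A copy given only as a set of pairs still determines its four vertices, as the union of
  the first components. The counts that follow are organised by this vertex set.\<close>

lemma rainbow_K4_props:
  assumes "A \<in> rainbow_K4_copies V E L"
  shows "card A = 6" "finite A" "inj_on fst A" "\<Union>(fst ` A) \<in> [V]\<^bsup>4\<^esup>" "fst ` A = [\<Union>(fst ` A)]\<^bsup>2\<^esup>"
proof -
  from assms obtain K c where K: "K \<in> [V]\<^bsup>4\<^esup>" "[K]\<^bsup>2\<^esup> \<subseteq> E" "A = (\<lambda>e. (e, c e)) ` [K]\<^bsup>2\<^esup>"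
    "\<And>e. e \<in> [K]\<^bsup>2\<^esup> \<Longrightarrow> c e \<in> L e"
    by (rule rainbow_K4E) blast
  have K': "finite K" "card K = 4" using K(1) unfolding nsets_def by auto
  have fA: "fst ` A = [K]\<^bsup>2\<^esup>" unfolding K(3) by (simp add: image_image)
  have UK: "\<Union>(fst ` A) = K" unfolding fA using K' by (intro Union_nsets_2) simp
  have "card ([K]\<^bsup>2\<^esup>) = 6" using K' by (simp add: card_nsets_eq choose_two)
  then show "card A = 6" unfolding K(3) by (subst card_image) (auto simp: inj_on_def)
  show "finite A" unfolding K(3) using K'(1) by (simp add: finite_imp_finite_nsets)
  show "inj_on fst A" unfolding K(3) by (auto simp: inj_on_def)
  show "\<Union>(fst ` A) \<in> [V]\<^bsup>4\<^esup>" unfolding UK by (rule K)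
  show "fst ` A = [\<Union>(fst ` A)]\<^bsup>2\<^esup>" unfolding UK by (rule fA)
qed

text \<open>For each four-vertex set there are at most \<open>r ^ 6\<close> ways to color its six
  edges.\<close>

lemma card_rainbow_K4_on_vertices:
  assumes "finite \<K>" "\<K> \<subseteq> [V]\<^bsup>4\<^esup>"
  shows "card {A\<in>all_rainbow_K4s r V E. \<Union>(fst ` A) \<in> \<K>} \<le> card \<K> * r ^ 6"
    "finite {A\<in>all_rainbow_K4s r V E. \<Union>(fst ` A) \<in> \<K>}"
proof -
  let ?g = "\<lambda>K. (\<lambda>c. (\<lambda>e. (e, c e)) ` [K]\<^bsup>2\<^esup>) ` ([K]\<^bsup>2\<^esup> \<rightarrow>\<^sub>E {1..r})"
  have g: "finite (?g K)" "card (?g K) \<le> r ^ 6" if "K \<in> \<K>" for K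
  proof -
    have K: "finite K" "card K = 4" using that assms(2) unfolding nsets_def by auto
    then have 6: "finite ([K]\<^bsup>2\<^esup>)" "card ([K]\<^bsup>2\<^esup>) = 6"
      by (auto simp: card_nsets_eq choose_two finite_imp_finite_nsets)
    then have fin: "finite ([K]\<^bsup>2\<^esup> \<rightarrow>\<^sub>E {1..r})" by (intro finite_PiE) auto
    then show "finite (?g K)" by simp
    have "card (?g K) \<le> card ([K]\<^bsup>2\<^esup> \<rightarrow>\<^sub>E {1..r})" using fin by (rule card_image_le)
    also have "\<dots> = r ^ 6" using 6 by (simp add: card_PiE)
    finally show "card (?g K) \<le> r ^ 6" .
  qed
  have sub: "{A\<in>all_rainbow_K4s r V E. \<Union>(fst ` A) \<in> \<K>} \<subseteq> (\<Union>K\<in>\<K>. ?g K)"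
  proof
    fix A assume A: "A \<in> {A\<in>all_rainbow_K4s r V E. \<Union>(fst ` A) \<in> \<K>}"
    then have "A \<in> all_rainbow_K4s r V E" by simp
    then obtain K c where K: "K \<in> [V]\<^bsup>4\<^esup>" "A = (\<lambda>e. (e, c e)) ` [K]\<^bsup>2\<^esup>"
      "\<And>e. e \<in> [K]\<^bsup>2\<^esup> \<Longrightarrow> c e \<in> {1..r}"
      by (rule rainbow_K4E) blast
    have "fst ` A = [K]\<^bsup>2\<^esup>" unfolding K(2) by (simp add: image_image)
    moreover have "card K = 4" using K(1) unfolding nsets_def by auto
    ultimately have "K \<in> \<K>" using A Union_nsets_2[of K] by auto
    moreover have "A = (\<lambda>e. (e, restrict c ([K]\<^bsup>2\<^esup>) e)) ` [K]\<^bsup>2\<^esup>"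
      unfolding K(2) by (rule image_cong) auto
    moreover have "restrict c ([K]\<^bsup>2\<^esup>) \<in> [K]\<^bsup>2\<^esup> \<rightarrow>\<^sub>E {1..r}" using K(3) by auto
    ultimately show "A \<in> (\<Union>K\<in>\<K>. ?g K)" by blast
  qed
  have fin: "finite (\<Union>K\<in>\<K>. ?g K)" using assms(1) g(1) by blast
  then show "finite {A\<in>all_rainbow_K4s r V E. \<Union>(fst ` A) \<in> \<K>}" using sub finite_subset by blast
  have "card {A\<in>all_rainbow_K4s r V E. \<Union>(fst ` A) \<in> \<K>} \<le> card (\<Union>K\<in>\<K>. ?g K)"
    by (rule card_mono[OF fin sub])
  also have "\<dots> \<le> (\<Sum>K\<in>\<K>. card (?g K))" by (rule card_UN_le[OF assms(1)])
  also have "\<dots> \<le> (\<Sum>K\<in>\<K>. r ^ 6)" by (rule sum_mono) (rule g(2))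
  finally show "card {A\<in>all_rainbow_K4s r V E. \<Union>(fst ` A) \<in> \<K>} \<le> card \<K> * r ^ 6" by simp
qed

lemma card_all_rainbow_K4s:
  assumes "finite V"
  shows "card (all_rainbow_K4s r V E) \<le> (card V choose 4) * r ^ 6" "finite (all_rainbow_K4s r V E)"
proof -
  have "{A\<in>all_rainbow_K4s r V E. \<Union>(fst ` A) \<in> [V]\<^bsup>4\<^esup>} = all_rainbow_K4s r V E"
    using rainbow_K4_props(4) by auto
  then show "card (all_rainbow_K4s r V E) \<le> (card V choose 4) * r ^ 6" "finite (all_rainbow_K4s r V E)"
    using card_rainbow_K4_on_vertices[where \<K> = "[V]\<^bsup>4\<^esup>" and V = V and r = r and E = E] assms
    by (auto simp: card_nsets_eq finite_imp_finite_nsets)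
qed

text \<open>If \<open>S\<close> lies in a copy, its pairs have distinct edges, all spanned by the
  vertex set \<open>U\<close>, so \<open>card S\<close> is at most \<open>card U choose 2\<close>.
  Two edges force three vertices, leaving at most \<open>card V\<close> choices for the copy's
  vertex set; four edges force four vertices, which determine it.\<close>

lemma codegree_rainbow_K4s:
  assumes fin: "finite V" and V: "V \<noteq> {}" and S: "card S \<ge> 2"
  shows "card {A\<in>all_rainbow_K4s r V E. S \<subseteq> A} \<le> card V * r ^ 6"
    "card S \<ge> 4 \<Longrightarrow> card {A\<in>all_rainbow_K4s r V E. S \<subseteq> A} \<le> r ^ 6"
    "card S > 6 \<Longrightarrow> card {A\<in>all_rainbow_K4s r V E. S \<subseteq> A} = 0"
proof -
  let ?AS = "{A\<in>all_rainbow_K4s r V E. S \<subseteq> A}"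
  define U where "U = \<Union>(fst ` S)"
  show "card ?AS = 0" if "card S > 6"
  proof -
    have "\<not> S \<subseteq> A" if "A \<in> all_rainbow_K4s r V E" for A
      using card_mono[of A S] rainbow_K4_props(1,2)[OF that] \<open>card S > 6\<close> by auto
    then have "?AS = {}" by auto
    then show ?thesis by (simp only: card.empty)
  qed
  have U: "finite U \<and> card S \<le> card U choose 2" if "A \<in> ?AS" for A
  proof
    have A: "A \<in> all_rainbow_K4s r V E" "S \<subseteq> A" using that by auto
    note p = rainbow_K4_props[OF A(1)]
    have "finite (\<Union>(fst ` A))" using p(4) unfolding nsets_def by auto
    moreover have "U \<subseteq> \<Union>(fst ` A)" using A(2) unfolding U_def by auto
    ultimately show finU: "finite U" using finite_subset by auto
    have "e \<in> [U]\<^bsup>2\<^esup>" if "e \<in> fst ` S" for e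
    proof -
      have "e \<in> [\<Union>(fst ` A)]\<^bsup>2\<^esup>" using that A(2) p(5) by blast
      moreover have "e \<subseteq> U" using that unfolding U_def by auto
      ultimately show ?thesis unfolding nsets_def by auto
    qed
    then have "card (fst ` S) \<le> card ([U]\<^bsup>2\<^esup>)"
      using finU by (intro card_mono) (auto simp: finite_imp_finite_nsets)
    moreover have "card (fst ` S) = card S"
      by (rule card_image) (rule inj_on_subset[OF p(3) A(2)])
    ultimately show "card S \<le> card U choose 2" using card_nsets_eq[OF finU] by simp
  qed
  have sub: "?AS \<subseteq> {A\<in>all_rainbow_K4s r V E. \<Union>(fst ` A) \<in> {K\<in>[V]\<^bsup>4\<^esup>. U \<subseteq> K}}"
    using rainbow_K4_props(4) unfolding U_def by blast
  have finK: "finite {K\<in>[V]\<^bsup>4\<^esup>. U \<subseteq> K}" using fin by (simp add: finite_imp_finite_nsets)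
  have "card ?AS \<le> card {A\<in>all_rainbow_K4s r V E. \<Union>(fst ` A) \<in> {K\<in>[V]\<^bsup>4\<^esup>. U \<subseteq> K}}"
    by (rule card_mono[OF card_rainbow_K4_on_vertices(2)[OF finK] sub]) auto
  also have "\<dots> \<le> card {K\<in>[V]\<^bsup>4\<^esup>. U \<subseteq> K} * r ^ 6"
    by (rule card_rainbow_K4_on_vertices(1)[OF finK]) auto
  finally have le: "card ?AS \<le> card {K\<in>[V]\<^bsup>4\<^esup>. U \<subseteq> K} * r ^ 6" .
  have one: "card {K\<in>[V]\<^bsup>4\<^esup>. U \<subseteq> K} \<le> 1" if "card U \<ge> 4"
  proof -
    have "K = U" if "K \<in> [V]\<^bsup>4\<^esup>" "U \<subseteq> K" for K
      using that \<open>card U \<ge> 4\<close> card_seteq[of K U] unfolding nsets_def by auto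
    then have "{K\<in>[V]\<^bsup>4\<^esup>. U \<subseteq> K} \<subseteq> {U}" by blast
    then show ?thesis using card_mono[of "{U}"] by fastforce
  qed
  have choose_mono: "m choose 2 \<le> n choose 2" if "m \<le> n" for m n :: nat
    using that by (rule binomial_right_mono)
  show "card ?AS \<le> r ^ 6" if "card S \<ge> 4"
  proof (cases "?AS = {}")
    case False
    then have "4 \<le> card U choose 2" using U that by (metis (no_types, lifting) ex_in_conv le_trans)
    then have "\<not> card U \<le> 3" using choose_mono[of "card U" 3] by (auto simp: choose_two)
    then have "card {K\<in>[V]\<^bsup>4\<^esup>. U \<subseteq> K} \<le> 1" by (intro one) auto
    then show ?thesis using le mult_le_mono1[of "card {K\<in>[V]\<^bsup>4\<^esup>. U \<subseteq> K}" 1 "r ^ 6"] by linarith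
  qed (simp only: card.empty)
  show "card ?AS \<le> card V * r ^ 6"
  proof (cases "?AS = {}")
    case False
    then have 2: "2 \<le> card U choose 2" and finU: "finite U"
      using U S by (metis (no_types, lifting) ex_in_conv le_trans)+
    have "\<not> card U \<le> 2" using 2 choose_mono[of "card U" 2] by auto
    then consider "card U = 3" | "card U \<ge> 4" by linarith
    then have "card {K\<in>[V]\<^bsup>4\<^esup>. U \<subseteq> K} \<le> card V"
    proof cases
      case 1
      have "{K\<in>[V]\<^bsup>4\<^esup>. U \<subseteq> K} \<subseteq> (\<lambda>x. insert x U) ` V"
      proof
        fix K assume K: "K \<in> {K\<in>[V]\<^bsup>4\<^esup>. U \<subseteq> K}"
        then have K': "finite K" "card K = 4" "U \<subseteq> K" "K \<subseteq> V" unfolding nsets_def by auto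
        then have "card (K - U) = 1" using finU 1 by (simp add: card_Diff_subset)
        then obtain x where "K - U = {x}" by (auto simp: card_1_singleton_iff)
        then have "K = insert x U" "x \<in> V" using K' by auto
        then show "K \<in> (\<lambda>x. insert x U) ` V" by auto
      qed
      then have "card {K\<in>[V]\<^bsup>4\<^esup>. U \<subseteq> K} \<le> card ((\<lambda>x. insert x U) ` V)"
        using fin by (intro card_mono) auto
      also have "\<dots> \<le> card V" by (rule card_image_le[OF fin])
      finally show ?thesis .
    next
      case 2
      have "card V \<ge> 1" using fin V by (simp add: Suc_le_eq card_gt_0_iff)
      then show ?thesis using one[OF 2] by linarith
    qed
    then show ?thesis using le mult_le_mono1[of "card {K\<in>[V]\<^bsup>4\<^esup>. U \<subseteq> K}" "card V" "r ^ 6"] by linarith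
  qed (simp only: card.empty)
qed

section \<open>The container step for rainbow copies of K4\<close>

text \<open>Used with \<open>x\<close> the cube root of \<open>n\<close>, \<open>R = r ^ 6\<close>
  and \<open>m\<close> the codegree of a set of size \<open>j\<close>. The exponent 1/3 balances the
  extreme cases: after multiplication by \<open>x ^ (j - 1)\<close>, both \<open>j = 3\<close> and
  \<open>j = 6\<close> give \<open>R * x ^ 5\<close>, the order of the average degree. A large
  \<open>B\<close> absorbs the remaining constants.\<close>

lemma codegree_condition:
  fixes x B h d m R :: real
  assumes x: "x \<ge> 1" and B: "B \<ge> 1" "36 * R \<le> B * h ^ 6" and h: "0 < h" "h \<le> 1"
    and d: "x ^ 5 / 36 \<le> d" and R: "R \<ge> 0" and j: "2 \<le> j" "j \<le> 6"
    and m: "m \<le> x ^ 3 * R" "j \<ge> 4 \<Longrightarrow> m \<le> R"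
  shows "m \<le> (B / x) ^ (j - 1) * h ^ j * d"
proof -
  have "m * x ^ (j - 1) \<le> R * x ^ 5"
  proof (cases "j \<ge> 4")
    case True
    have "m * x ^ (j - 1) \<le> R * x ^ (j - 1)"
      using m(2)[OF True] x by (intro mult_right_mono) auto
    also have "\<dots> \<le> R * x ^ 5"
      using j R x by (intro mult_left_mono power_increasing) auto
    finally show ?thesis .
  next
    case False
    have "m * x ^ (j - 1) \<le> x ^ 3 * R * x ^ (j - 1)"
      using m(1) x by (intro mult_right_mono) auto
    also have "\<dots> \<le> x ^ 3 * R * x ^ 2"
      using False R x by (intro mult_left_mono power_increasing) auto
    also have "\<dots> = R * x ^ 5" by (simp add: power_add[symmetric] mult.commute mult.left_commute)
    finally show ?thesis .
  qed
  also have "R * x ^ 5 \<le> B * h ^ 6 / 36 * x ^ 5"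
    using B(2) x by (intro mult_right_mono) auto
  also have "\<dots> = B * h ^ 6 * (x ^ 5 / 36)" by simp
  also have "\<dots> \<le> B * h ^ 6 * d"
    using B h d by (intro mult_left_mono) auto
  also have "\<dots> \<le> B ^ (j - 1) * h ^ j * d"
  proof -
    have "B ^ 1 \<le> B ^ (j - 1)" using B j by (intro power_increasing) auto
    moreover have "h ^ 6 \<le> h ^ j" using h j by (intro power_decreasing) auto
    moreover have "d \<ge> 0" using d x by (smt (verit) divide_nonneg_pos zero_le_power)
    ultimately show ?thesis using B h by (intro mult_right_mono mult_mono) auto
  qed
  finally have "m * x ^ (j - 1) \<le> B ^ (j - 1) * h ^ j * d" .
  then have "m \<le> B ^ (j - 1) * h ^ j * d / x ^ (j - 1)"
    using x by (subst pos_le_divide_eq) auto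
  then show ?thesis by (simp add: power_divide)
qed

lemma real_choose_two: "real (n choose 2) = real n * (real n - 1) / 2"
proof -
  have "even (n * (n - 1))" by (cases n) auto
  then have "2 * (n choose 2) = n * (n - 1)" by (simp add: choose_two)
  then have "2 * real (n choose 2) = real (n * (n - 1))" by (metis of_nat_mult of_nat_numeral)
  then show ?thesis by (cases n) (auto simp: algebra_simps)
qed

lemma real_nat_ceiling_le: "0 \<le> y \<Longrightarrow> real (nat \<lceil>y\<rceil>) \<le> y + 1"
  using of_int_ceiling_le_add_one[of y] by simp

lemma choose_four_ge:
  assumes "n \<ge> 6"
  shows "real (n choose 2) * (real n)\<^sup>2 / 36 \<le> real (n choose 4)"
proof -
  have "(n choose 4) * (4 choose 2) = (n choose 2) * ((n - 2) choose (4 - 2))"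
    using assms by (intro choose_mult) auto
  then have "(n choose 4) * 6 = (n choose 2) * ((n - 2) choose 2)" by (simp add: choose_two)
  then have "real (n choose 4) * 6 = real (n choose 2) * real ((n - 2) choose 2)"
    by (metis of_nat_mult of_nat_numeral)
  moreover have "real ((n - 2) choose 2) \<ge> (real n)\<^sup>2 / 6"
  proof -
    \<comment> \<open>Clearing denominators in the desired inequality leaves exactly this product;
      its root 6 explains the bound on \<open>n\<close>.\<close>
    have "(2 * real n - 3) * (real n - 6) \<ge> 0" using assms by (intro mult_nonneg_nonneg) auto
    then have "(real n)\<^sup>2 / 6 \<le> (real n - 2) * (real n - 2 - 1) / 2"
      by (simp add: field_simps power2_eq_square)
    then show ?thesis unfolding real_choose_two using assms by (simp add: of_nat_diff)
  qed
  ultimately have "real (n choose 2) * ((real n)\<^sup>2 / 6) \<le> real (n choose 4) * 6"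
    by (metis mult_left_mono of_nat_0_le_iff)
  then show ?thesis by simp
qed

text \<open>As long as \<open>C\<close> has more rainbow copies than the target, the average degree
  is of order \<open>x ^ 5\<close>, which is what the codegree condition needs.\<close>

lemma K4_container_step:
  fixes V :: "'a set" and r :: nat and B \<delta> :: real
  assumes V: "finite V" "E \<subseteq> [V]\<^bsup>2\<^esup>" "card V = n" "n \<ge> 6" and r: "r \<ge> 1"
    and \<delta>: "\<delta> = 1 / (4 * (real 6 + 1) * (1 + 4 * 2 ^ 6) ^ 6)"
    and B: "B \<ge> 1" "36 * real r ^ 6 \<le> B * (\<delta> / 2) ^ 6"
    and x: "x \<ge> 1" "x ^ 3 = real n"
    and t: "28 * (B / x) * real (r * (n choose 2)) \<le> real t"
    and C: "C \<subseteq> E \<times> {1..r}"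
    and T: "real r ^ 4 / x * real (n choose 4) < real (card {A\<in>all_rainbow_K4s r V E. A \<subseteq> C})"
  shows "\<exists>\<C>. \<C> \<subseteq> Pow C \<and> card \<C> \<le> (r * (n choose 2) + 1) ^ (6 * t) \<and>
     (\<forall>D\<in>\<C>. real (card {A\<in>all_rainbow_K4s r V E. A \<subseteq> D})
        \<le> (1 - \<delta> / 12) * real (card {A\<in>all_rainbow_K4s r V E. A \<subseteq> C})) \<and>
     (\<forall>I. I \<subseteq> C \<longrightarrow> (\<forall>A\<in>all_rainbow_K4s r V E. \<not> A \<subseteq> I) \<longrightarrow> (\<exists>D\<in>\<C>. I \<subseteq> D))"
proof -
  define \<H> where "\<H> = {A\<in>all_rainbow_K4s r V E. A \<subseteq> C}"
  \<comment> \<open>An upper bound on the number of pairs that is valid for every \<open>C\<close>,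
    so one \<open>t\<close> serves all stages of the iteration.\<close>
  define N where "N = real (r * (n choose 2))"
  have finE: "finite E" using V finite_imp_finite_nsets finite_subset by blast
  have finC: "finite C" using C finE finite_subset by blast
  have "card E \<le> n choose 2"
    using card_mono[OF finite_imp_finite_nsets V(2)] V card_nsets_eq by metis
  then have "card (E \<times> {1..r}) \<le> r * (n choose 2)"
    by (simp add: card_cartesian_product mult.commute)
  moreover have "card C \<le> card (E \<times> {1..r})" using C finE by (intro card_mono) auto
  ultimately have cC: "card C \<le> r * (n choose 2)" by linarith
  have c2: "real (n choose 2) > 0" using V(4) by simp
  then have N: "real (card C) \<le> N" "N > 0" unfolding N_def using cC r by (simp_all del: of_nat_mult)
  have e: "real r ^ 4 / x * real (n choose 4) < real (card \<H>)" using T unfolding \<H>_def .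
  have "real r ^ 4 / x * real (n choose 4) \<ge> 0" using x by auto
  then have ne: "\<H> \<noteq> {}" using e by auto
  have sub: "\<H> \<subseteq> [C]\<^bsup>6\<^esup>" unfolding \<H>_def nsets_def using rainbow_K4_props(1,2) by auto
  have d: "x ^ 5 / 36 \<le> real (card \<H>) / N"
  proof -
    have "x ^ 5 / 36 * N = real r * (real (n choose 2) * (real n)\<^sup>2 / 36) / x"
    proof -
      have "(real n)\<^sup>2 / x = x ^ 5"
        unfolding x(2)[symmetric] using x(1) by (simp add: power_mult[symmetric] eval_nat_numeral)
      then show ?thesis unfolding N_def by (simp add: mult_ac flip: times_divide_eq_right)
    qed
    also have "\<dots> \<le> real r ^ 4 * real (n choose 4) / x"
    proof -
      have "real r ^ 1 \<le> real r ^ 4" using r by (intro power_increasing) auto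
      then show ?thesis
        using choose_four_ge[OF V(4)] x by (intro divide_right_mono mult_mono) auto
    qed
    also have "\<dots> \<le> real (card \<H>)" using e by simp
    finally show ?thesis using N by (subst pos_le_divide_eq) auto
  qed
  have \<delta>': "0 < \<delta> / 2" "\<delta> / 2 \<le> 1" unfolding \<delta> by simp_all
  \<comment> \<open>At uniformity 6 the constants 28 and 12 arise as \<open>4 * (6 + 1)\<close> and
    \<open>2 * 6\<close>.\<close>
  have "\<exists>\<C>. \<C> \<subseteq> Pow C \<and> card \<C> \<le> (card C + 1) ^ (6 * t) \<and>
     (\<forall>D\<in>\<C>. real (card {A\<in>\<H>. A \<subseteq> D}) \<le> (1 - \<delta> / (2 * real 6)) * real (card \<H>)) \<and>
     (\<forall>I. I \<subseteq> C \<longrightarrow> (\<forall>A\<in>\<H>. \<not> A \<subseteq> I) \<longrightarrow> (\<exists>D\<in>\<C>. I \<subseteq> D))"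
  proof (rule unweighted_containers[OF finC sub ne _ N _ \<delta>])
    show "B / x > 0" using B x by auto
    show "4 * (B / x) * (real 6 + 1) * N \<le> real t" using t unfolding N_def by simp
    fix S assume S: "S \<subseteq> C" "card S \<ge> 2"
    have fin: "finite {A\<in>all_rainbow_K4s r V E. S \<subseteq> A}"
      using card_all_rainbow_K4s(2)[OF V(1)] by simp
    have le: "card {A\<in>\<H>. S \<subseteq> A} \<le> card {A\<in>all_rainbow_K4s r V E. S \<subseteq> A}"
      unfolding \<H>_def by (rule card_mono[OF fin]) auto
    have Vne: "V \<noteq> {}" using V by auto
    show "real (card {A\<in>\<H>. S \<subseteq> A}) \<le> (B / x) ^ (card S - 1) * (\<delta> / 2) ^ card S * (real (card \<H>) / N)"
    proof (cases "card S \<le> 6")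
      case True
      show ?thesis
      proof (rule codegree_condition[OF x(1) B \<delta>' d _ S(2) True])
        have "card {A\<in>\<H>. S \<subseteq> A} \<le> n * r ^ 6"
          using le codegree_rainbow_K4s(1)[OF V(1) Vne S(2), of E r] V(3) by simp
        then have "real (card {A\<in>\<H>. S \<subseteq> A}) \<le> real (n * r ^ 6)" by (simp only: of_nat_le_iff)
        then show "real (card {A\<in>\<H>. S \<subseteq> A}) \<le> x ^ 3 * real r ^ 6" unfolding x(2) by simp
        assume "4 \<le> card S"
        then have "card {A\<in>\<H>. S \<subseteq> A} \<le> r ^ 6"
          using le codegree_rainbow_K4s(2)[OF V(1) Vne S(2), of E r] by simp
        then have "real (card {A\<in>\<H>. S \<subseteq> A}) \<le> real (r ^ 6)" by (simp only: of_nat_le_iff)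
        then show "real (card {A\<in>\<H>. S \<subseteq> A}) \<le> real r ^ 6" by simp
      qed simp
    next
      case False
      then have "card {A\<in>\<H>. S \<subseteq> A} = 0"
        using le codegree_rainbow_K4s(3)[OF V(1) Vne S(2), of E r] by simp
      then show ?thesis using B x \<delta>' N by simp
    qed
  qed auto
  then obtain \<C> where \<C>: "\<C> \<subseteq> Pow C" "card \<C> \<le> (card C + 1) ^ (6 * t)"
     "\<forall>D\<in>\<C>. real (card {A\<in>\<H>. A \<subseteq> D}) \<le> (1 - \<delta> / (2 * real 6)) * real (card \<H>)"
     "\<forall>I. I \<subseteq> C \<longrightarrow> (\<forall>A\<in>\<H>. \<not> A \<subseteq> I) \<longrightarrow> (\<exists>D\<in>\<C>. I \<subseteq> D)"
    by (elim exE conjE)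
  have "card \<C> \<le> (r * (n choose 2) + 1) ^ (6 * t)"
    by (rule order_trans[OF \<C>(2) power_mono]) (use cC in auto)
  moreover have "{A\<in>\<H>. A \<subseteq> D} = {A\<in>all_rainbow_K4s r V E. A \<subseteq> D}" if "D \<in> \<C>" for D
    using \<C>(1) that unfolding \<H>_def by auto
  moreover have "\<forall>A\<in>\<H>. \<not> A \<subseteq> I" if "\<forall>A\<in>all_rainbow_K4s r V E. \<not> A \<subseteq> I" for I
    using that unfolding \<H>_def by auto
  ultimately show ?thesis
    using \<C>(1,3,4) unfolding \<H>_def[symmetric] by (intro exI[of _ \<C>] conjI) simp_all
qed

section \<open>Counting iterations and containers\<close>

text \<open>The initial number of copies exceeds the target by a factor of at most
  \<open>r ^ 2 * x\<close>, so about \<open>ln (r ^ 2 * x) / \<delta>\<close> rounds suffice by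
  \<open>1 - \<delta> \<le> exp (- \<delta>)\<close>. As \<open>r\<close> and \<open>x\<close> are
  at most \<open>n\<close>, the logarithm is at most \<open>3 * ln n\<close>.\<close>

lemma iteration_count:
  fixes x \<delta> :: real
  assumes n: "n \<ge> 3" "n \<ge> r" and r: "r \<ge> 1" and x: "1 \<le> x" "x \<le> real n" and \<delta>: "0 < \<delta>" "\<delta> \<le> 1"
  shows "\<exists>i. (1 - \<delta>) ^ i * real r ^ 2 \<le> 1 / x \<and> real i \<le> (3 / \<delta> + 1) * log 2 (real n)"
proof -
  define i where "i = nat \<lceil>ln (real r ^ 2 * x) / \<delta>\<rceil>"
  have rx: "real r ^ 2 * x > 0" using r x by auto
  have "1 * 1 \<le> real r ^ 2 * x" using r x by (intro mult_mono) auto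
  then have ln0: "ln (real r ^ 2 * x) \<ge> 0" by simp
  \<comment> \<open>For \<open>n \<ge> 3\<close> the value \<open>ln n\<close> is at least 1 and so
    absorbs the rounding error of the ceiling.\<close>
  have "exp 1 \<le> (3::real)" by (rule exp_le)
  then have ln1: "ln (real n) \<ge> 1" using n ln_ge_iff[of "real n" 1] by simp
  have "ln (2::real) \<le> 1" using ln_le_minus_one[of "2::real"] by simp
  then have log: "ln (real n) \<le> log 2 (real n)"
    unfolding log_def using ln1 mult_right_mono[of "ln 2" 1 "ln (real n)"] by (subst pos_le_divide_eq) (auto simp: mult.commute)
  have "ln (real r ^ 2 * x) = 2 * ln (real r) + ln x"
    using r x by (simp add: ln_mult ln_realpow)
  also have "\<dots> \<le> 2 * ln (real n) + ln (real n)"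
    using r x n by (intro add_mono mult_left_mono) auto
  finally have lnle: "ln (real r ^ 2 * x) \<le> 3 * ln (real n)" by simp
  have ige: "ln (real r ^ 2 * x) / \<delta> \<le> real i" unfolding i_def by (rule real_nat_ceiling_ge)
  have "real i \<le> ln (real r ^ 2 * x) / \<delta> + 1"
    unfolding i_def using ln0 \<delta> by (intro real_nat_ceiling_le) simp
  also have "\<dots> \<le> 3 * ln (real n) / \<delta> + ln (real n)"
    using lnle \<delta> ln1 by (intro add_mono divide_right_mono) auto
  also have "\<dots> = (3 / \<delta> + 1) * ln (real n)" by (simp add: algebra_simps)
  also have "\<dots> \<le> (3 / \<delta> + 1) * log 2 (real n)" using log \<delta> by (intro mult_left_mono) auto
  finally have ile: "real i \<le> (3 / \<delta> + 1) * log 2 (real n)" .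
  have "(1 - \<delta>) ^ i \<le> exp (- \<delta>) ^ i"
    using \<delta> exp_ge_add_one_self[of "- \<delta>"] by (intro power_mono) auto
  also have "\<dots> = exp (- (\<delta> * real i))" by (simp add: exp_of_nat_mult[symmetric] mult.commute)
  also have "\<dots> \<le> exp (- ln (real r ^ 2 * x))"
    using ige \<delta> by (simp add: field_simps)
  also have "\<dots> = 1 / (real r ^ 2 * x)" using rx by (simp add: exp_minus inverse_eq_divide)
  finally have "(1 - \<delta>) ^ i * real r ^ 2 \<le> 1 / (real r ^ 2 * x) * real r ^ 2"
    by (intro mult_right_mono) auto
  also have "\<dots> = 1 / x" using r by simp
  finally show ?thesis using ile by blast
qed

text \<open>A copy contained in the graph of \<open>\<phi>\<close> must use the colors of
  \<open>\<phi>\<close> and would thus be rainbow under it.\<close>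

lemma coloring_independent:
  assumes "rainbow_K4_free V E \<phi>" "A \<in> all_rainbow_K4s r V E"
  shows "\<not> A \<subseteq> (\<lambda>e. (e, \<phi> e)) ` E"
proof
  assume sub: "A \<subseteq> (\<lambda>e. (e, \<phi> e)) ` E"
  from assms(2) obtain F c where F: "F \<in> K4_copies V E" "inj_on c F" "A = (\<lambda>e. (e, c e)) ` F"
    unfolding rainbow_K4_copies_def by blast
  have "c e = \<phi> e" if "e \<in> F" for e using sub that unfolding F(3) by auto
  then have "inj_on \<phi> F" using F(2) inj_on_cong by metis
  then show False using assms(1) F(1) unfolding rainbow_K4_free_def by blast
qed

text \<open>One logarithm comes from the base, which is at most \<open>n ^ 3\<close> because
  \<open>r \<le> n\<close>, the other from the number \<open>i\<close> of rounds. The factor 18 is 3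
  from this base times 6 from the uniformity.\<close>

lemma K4_container_count:
  fixes n r t i :: nat and x B a :: real
  assumes n: "n \<ge> 6" "n \<ge> r" and r: "r \<ge> 1" and x: "x \<ge> 1" "x \<le> real n" and B: "B \<ge> 1" and a: "a \<ge> 0"
    and t: "real t \<le> 28 * (B / x) * real (r * (n choose 2)) + 1"
    and i: "real i \<le> a * log 2 (real n)"
  shows "real (((r * (n choose 2) + 1) ^ (6 * t)) ^ i)
     \<le> 2 powr (18 * (28 * B + 1) * real r * a * (1 / x) * real (n choose 2) * (log 2 (real n))\<^sup>2)"
proof -
  define N where "N = r * (n choose 2)"
  have log: "log 2 (real n) \<ge> 0" using n by simp
  have N1: "N + 1 \<le> n ^ 3"
  proof -
    have "N * 2 \<le> r * (n * (n - 1))" unfolding N_def by (simp add: choose_two mult.assoc)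
    also have "\<dots> \<le> n * (n * (n - 1))" using n by simp
    also have "\<dots> \<le> n * (n * n)" by simp
    finally have "N * 2 \<le> n ^ 3" by (simp add: power3_eq_cube)
    moreover have "2 ^ 3 \<le> n ^ 3" using n by (intro power_mono) auto
    ultimately show ?thesis by simp
  qed
  \<comment> \<open>This makes \<open>N / x\<close> at least 1, so the \<open>+ 1\<close> in the
    bound on \<open>t\<close> fits into the factor \<open>28 * B + 1\<close>.\<close>
  have xN: "x \<le> real N"
  proof -
    have "1 \<le> (real n - 1) / 2" using n by simp
    then have "real n * 1 \<le> real n * ((real n - 1) / 2)" by (intro mult_left_mono) auto
    also have "\<dots> = real (n choose 2)" unfolding real_choose_two by simp
    also have "\<dots> \<le> real N"
      unfolding N_def using r mult_right_mono[of 1 "real r" "real (n choose 2)"] by simp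
    finally show ?thesis using x by simp
  qed
  have "1 \<le> real N / x" using xN x by (subst pos_le_divide_eq) auto
  then have t': "real t \<le> (28 * B + 1) * (real N / x)"
    using t unfolding N_def[symmetric] by (simp add: algebra_simps)
  have "real t * real i \<le> ((28 * B + 1) * (real N / x)) * (a * log 2 (real n))"
    using t' i a B x log by (intro mult_mono) auto
  then have "real (18 * t * i) * log 2 (real n) \<le> 18 * (((28 * B + 1) * (real N / x)) * (a * log 2 (real n))) * log 2 (real n)"
    using log by (intro mult_right_mono) auto
  also have "\<dots> = 18 * (28 * B + 1) * real r * a * (1 / x) * real (n choose 2) * (log 2 (real n))\<^sup>2"
    unfolding N_def by (simp add: power2_eq_square mult_ac)
  finally have le: "real (18 * t * i) * log 2 (real n)
      \<le> 18 * (28 * B + 1) * real r * a * (1 / x) * real (n choose 2) * (log 2 (real n))\<^sup>2" .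
  have "((N + 1) ^ (6 * t)) ^ i \<le> ((n ^ 3) ^ (6 * t)) ^ i"
    using N1 by (intro power_mono) auto
  also have "\<dots> = n ^ (18 * t * i)" by (simp add: power_mult[symmetric] mult_ac)
  finally have "real (((N + 1) ^ (6 * t)) ^ i) \<le> real n ^ (18 * t * i)"
    by (metis of_nat_le_iff of_nat_power)
  also have "\<dots> = 2 powr (real (18 * t * i) * log 2 (real n))"
    using n log_nat_power[of "real n" 2 "18 * t * i"] powr_log_cancel[of 2 "real n ^ (18 * t * i)"] by simp
  also have "\<dots> \<le> 2 powr (18 * (28 * B + 1) * real r * a * (1 / x) * real (n choose 2) * (log 2 (real n))\<^sup>2)"
    using le by (intro powr_mono) auto
  finally show ?thesis unfolding N_def .
qed

section \<open>From containers to templates\<close>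

lemma rainbow_K4_containers:
  fixes V :: "'a set" and r :: nat and \<delta> B :: real
  assumes r: "r \<ge> 1" and G: "simple_graph V E" "card V = n" and n: "n \<ge> 6" "n \<ge> r"
    and \<delta>: "\<delta> = 1 / (4 * (real 6 + 1) * (1 + 4 * 2 ^ 6) ^ 6)"
    and B: "B \<ge> 1" "36 * real r ^ 6 \<le> B * (\<delta> / 2) ^ 6"
  shows "\<exists>\<C>. \<C> \<subseteq> Pow (E \<times> {1..r}) \<and>
     real (card \<C>) \<le> 2 powr (18 * (28 * B + 1) * real r * (36 / \<delta> + 1) * real n powr (- 1 / 3)
        * real (n choose 2) * (log 2 (real n))\<^sup>2) \<and>
     (\<forall>C\<in>\<C>. real (card {A\<in>all_rainbow_K4s r V E. A \<subseteq> C})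
        \<le> real r ^ 4 * real n powr (- 1 / 3) * real (n choose 4)) \<and>
     (\<forall>I. I \<subseteq> E \<times> {1..r} \<longrightarrow> (\<forall>A\<in>all_rainbow_K4s r V E. \<not> A \<subseteq> I) \<longrightarrow> (\<exists>C\<in>\<C>. I \<subseteq> C))"
proof -
  have V: "finite V" "E \<subseteq> [V]\<^bsup>2\<^esup>" using G unfolding simple_graph_def by auto
  have finE: "finite E" using V finite_imp_finite_nsets finite_subset by blast
  define x where "x = real n powr (1 / 3)"
  have x: "x \<ge> 1" "x \<le> real n" "x ^ 3 = real n"
  proof -
    show "x \<ge> 1" unfolding x_def using n by (intro ge_one_powr_ge_zero) auto
    have "real n powr (1 / 3) \<le> real n powr 1" using n by (intro powr_mono) auto
    then show "x \<le> real n" unfolding x_def using n by simp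
    show "x ^ 3 = real n" unfolding x_def using n by (simp add: powr_realpow[symmetric] powr_powr)
  qed
  have xinv: "real n powr (- 1 / 3) = 1 / x"
    unfolding x_def using powr_minus_divide[of "real n" "1 / 3"] by simp
  define f where "f C = real (card {A\<in>all_rainbow_K4s r V E. A \<subseteq> C})" for C
  define T where "T = real r ^ 4 / x * real (n choose 4)"
  define t where "t = nat \<lceil>28 * (B / x) * real (r * (n choose 2))\<rceil>"
  have t0: "28 * (B / x) * real (r * (n choose 2)) \<ge> 0" using B x by simp
  have t: "28 * (B / x) * real (r * (n choose 2)) \<le> real t"
    unfolding t_def by (rule real_nat_ceiling_ge)
  have t': "real t \<le> 28 * (B / x) * real (r * (n choose 2)) + 1"
    unfolding t_def using t0 by (rule real_nat_ceiling_le)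
  have \<delta>': "0 < \<delta> / 12" "\<delta> / 12 \<le> 1" unfolding \<delta> by simp_all
  obtain i where i: "(1 - \<delta> / 12) ^ i * real r ^ 2 \<le> 1 / x" "real i \<le> (3 / (\<delta> / 12) + 1) * log 2 (real n)"
    using iteration_count[OF _ n(2) r x(1,2) \<delta>'] n by auto
  have "\<exists>\<C>. \<C> \<subseteq> Pow (E \<times> {1..r}) \<and> card \<C> \<le> ((r * (n choose 2) + 1) ^ (6 * t)) ^ i \<and> (\<forall>D\<in>\<C>. f D \<le> T) \<and>
         (\<forall>I. I \<subseteq> E \<times> {1..r} \<longrightarrow> (\<forall>A\<in>all_rainbow_K4s r V E. \<not> A \<subseteq> I) \<longrightarrow> (\<exists>D\<in>\<C>. I \<subseteq> D))"
  proof (rule iterated_containers[where X = "E \<times> {1..r}" and \<delta> = "\<delta> / 12"])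
    show "\<exists>\<C>. \<C> \<subseteq> Pow C \<and> card \<C> \<le> (r * (n choose 2) + 1) ^ (6 * t) \<and>
        (\<forall>D\<in>\<C>. f D \<le> (1 - \<delta> / 12) * f C) \<and>
        (\<forall>I. I \<subseteq> C \<longrightarrow> (\<forall>A\<in>all_rainbow_K4s r V E. \<not> A \<subseteq> I) \<longrightarrow> (\<exists>D\<in>\<C>. I \<subseteq> D))"
      if "C \<subseteq> E \<times> {1..r}" "T < f C" for C
      unfolding f_def
      by (rule K4_container_step[OF V G(2) n(1) r \<delta> B x(1,3) t that(1)])
         (use that(2) in \<open>simp add: T_def f_def\<close>)
    \<comment> \<open>The starting set \<open>E \<times> {1..r}\<close> has at most
      \<open>r ^ 6 * (n choose 4)\<close> copies, a factor \<open>r ^ 2 * x\<close> above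
      \<open>T\<close>; the choice of \<open>i\<close> removes this factor.\<close>
    have "f (E \<times> {1..r}) \<le> real (card (all_rainbow_K4s r V E))"
      unfolding f_def using card_all_rainbow_K4s(2)[OF V(1)]
      by (intro of_nat_mono card_mono) auto
    also have "\<dots> \<le> real ((n choose 4) * r ^ 6)"
      using card_all_rainbow_K4s(1)[OF V(1), of E r] unfolding G(2) by (simp only: of_nat_le_iff)
    also have "\<dots> = real r ^ 2 * (real r ^ 4 * real (n choose 4))"
      by (simp add: eval_nat_numeral)
    finally have "f (E \<times> {1..r}) \<le> real r ^ 2 * (real r ^ 4 * real (n choose 4))" .
    then have "(1 - \<delta> / 12) ^ i * f (E \<times> {1..r})
        \<le> (1 - \<delta> / 12) ^ i * (real r ^ 2 * (real r ^ 4 * real (n choose 4)))"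
      using \<delta>' by (intro mult_left_mono zero_le_power) auto
    also have "\<dots> = ((1 - \<delta> / 12) ^ i * real r ^ 2) * (real r ^ 4 * real (n choose 4))"
      by (simp only: mult.assoc)
    also have "\<dots> \<le> 1 / x * (real r ^ 4 * real (n choose 4))"
      using i(1) by (intro mult_right_mono) auto
    finally show "(1 - \<delta> / 12) ^ i * f (E \<times> {1..r}) \<le> T" unfolding T_def by simp
  qed (use \<delta>' finE in auto)
  then obtain \<C> where \<C>: "\<C> \<subseteq> Pow (E \<times> {1..r})" "card \<C> \<le> ((r * (n choose 2) + 1) ^ (6 * t)) ^ i"
     "\<forall>D\<in>\<C>. f D \<le> T"
     "\<forall>I. I \<subseteq> E \<times> {1..r} \<longrightarrow> (\<forall>A\<in>all_rainbow_K4s r V E. \<not> A \<subseteq> I) \<longrightarrow> (\<exists>D\<in>\<C>. I \<subseteq> D)"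
    by (elim exE conjE)
  have "real (card \<C>) \<le> real (((r * (n choose 2) + 1) ^ (6 * t)) ^ i)"
    using \<C>(2) by (simp only: of_nat_le_iff)
  also have "\<dots> \<le> 2 powr (18 * (28 * B + 1) * real r * (36 / \<delta> + 1) * (1 / x) * real (n choose 2) * (log 2 (real n))\<^sup>2)"
    using i(2) \<delta>' by (intro K4_container_count[OF n r x(1,2) B(1) _ t']) auto
  finally show ?thesis
    using \<C>(1,3,4) unfolding xinv T_def f_def by (intro exI[of _ \<C>] conjI) simp_all
qed

theorem theorem2p4:
  fixes r :: nat
  assumes "r \<ge> 6"
  shows "\<exists>(n0::nat) (c::real). \<forall>(V::'a set) E (n::nat).
    simple_graph V E \<and> card V = n \<and> n \<ge> n0 \<longrightarrow>
    (\<exists>\<C>. \<C> \<subseteq> templates r E \<and>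
      (\<forall>\<phi>\<in>edge_colorings r E. rainbow_K4_free V E \<phi> \<longrightarrow>
         (\<exists>L\<in>\<C>. subtemplate E (coloring_template E \<phi>) L)) \<and>
      (\<forall>L\<in>\<C>. real (card (rainbow_K4_copies V E L))
                \<le> real r ^ 4 * real n powr (- 1 / 3) * real (n choose 4)) \<and>
      real (card \<C>)
        \<le> 2 powr (c * real n powr (- 1 / 3) * real (n choose 2) * (log 2 (real n)) ^ 2))"
proof -
  define \<delta> :: real where "\<delta> = 1 / (4 * (real 6 + 1) * (1 + 4 * 2 ^ 6) ^ 6)"
  \<comment> \<open>Chosen so that the second condition on \<open>B\<close> below holds, with
    \<open>\<delta>\<close> the proportion at uniformity 6.\<close>
  define B where "B = 1 + 36 * real r ^ 6 / (\<delta> / 2) ^ 6"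
  have \<delta>: "\<delta> > 0" unfolding \<delta>_def by simp
  have B: "B \<ge> 1" "36 * real r ^ 6 \<le> B * (\<delta> / 2) ^ 6"
    unfolding B_def using \<delta> by (auto simp: distrib_right)
  define c where "c = 18 * (28 * B + 1) * real r * (36 / \<delta> + 1)"
  show ?thesis
  \<comment> \<open>The bound 6 serves the binomial estimates, and \<open>r \<le> n\<close> lets
    logarithms of \<open>r\<close> be absorbed into those of \<open>n\<close>.\<close>
  proof (intro exI[of _ "max 6 r"] exI[of _ c] allI impI)
    fix V :: "'a set" and E n
    assume A: "simple_graph V E \<and> card V = n \<and> n \<ge> max 6 r"
    have "\<exists>\<C>. \<C> \<subseteq> Pow (E \<times> {1..r}) \<and>
       real (card \<C>) \<le> 2 powr (c * real n powr (- 1 / 3) * real (n choose 2) * (log 2 (real n))\<^sup>2) \<and>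
       (\<forall>C\<in>\<C>. real (card {A\<in>all_rainbow_K4s r V E. A \<subseteq> C})
          \<le> real r ^ 4 * real n powr (- 1 / 3) * real (n choose 4)) \<and>
       (\<forall>I. I \<subseteq> E \<times> {1..r} \<longrightarrow> (\<forall>A\<in>all_rainbow_K4s r V E. \<not> A \<subseteq> I) \<longrightarrow> (\<exists>C\<in>\<C>. I \<subseteq> C))"
      unfolding c_def by (rule rainbow_K4_containers[OF _ _ _ _ _ \<delta>_def B]) (use A assms in auto)
    then obtain \<C> where \<C>: "\<C> \<subseteq> Pow (E \<times> {1..r})"
       "real (card \<C>) \<le> 2 powr (c * real n powr (- 1 / 3) * real (n choose 2) * (log 2 (real n))\<^sup>2)"
       "\<forall>C\<in>\<C>. real (card {A\<in>all_rainbow_K4s r V E. A \<subseteq> C})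
          \<le> real r ^ 4 * real n powr (- 1 / 3) * real (n choose 4)"
       "\<forall>I. I \<subseteq> E \<times> {1..r} \<longrightarrow> (\<forall>A\<in>all_rainbow_K4s r V E. \<not> A \<subseteq> I) \<longrightarrow> (\<exists>C\<in>\<C>. I \<subseteq> C)"
      by (elim exE conjE)
    define templ where "templ C = (\<lambda>e\<in>E. C `` {e})" for C :: "('a set \<times> nat) set"
    have "finite V" "E \<subseteq> [V]\<^bsup>2\<^esup>" using A unfolding simple_graph_def by auto
    then have "finite E" using finite_imp_finite_nsets finite_subset by blast
    then have fin: "finite \<C>" using \<C>(1) by (meson finite_Pow_iff finite_SigmaI finite_atLeastAtMost finite_subset)
    show "\<exists>\<C>. \<C> \<subseteq> templates r E \<and>
      (\<forall>\<phi>\<in>edge_colorings r E. rainbow_K4_free V E \<phi> \<longrightarrow>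
         (\<exists>L\<in>\<C>. subtemplate E (coloring_template E \<phi>) L)) \<and>
      (\<forall>L\<in>\<C>. real (card (rainbow_K4_copies V E L))
                \<le> real r ^ 4 * real n powr (- 1 / 3) * real (n choose 4)) \<and>
      real (card \<C>)
        \<le> 2 powr (c * real n powr (- 1 / 3) * real (n choose 2) * (log 2 (real n)) ^ 2)"
    proof (intro exI[of _ "templ ` \<C>"] conjI ballI impI)
      show "templ ` \<C> \<subseteq> templates r E"
        using \<C>(1) unfolding templates_def templ_def by (fastforce simp: PiE_iff)
      show "\<exists>L\<in>templ ` \<C>. subtemplate E (coloring_template E \<phi>) L"
        if \<phi>: "\<phi> \<in> edge_colorings r E" "rainbow_K4_free V E \<phi>" for \<phi>
      proof -
        \<comment> \<open>The graph of \<open>\<phi>\<close> is an independent set of pairs; the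
          template of a container holding it is the required supertemplate.\<close>
        have "(\<lambda>e. (e, \<phi> e)) ` E \<subseteq> E \<times> {1..r}"
          using \<phi>(1) unfolding edge_colorings_def by (auto simp del: atLeastAtMost_iff)
        moreover have "\<forall>A\<in>all_rainbow_K4s r V E. \<not> A \<subseteq> (\<lambda>e. (e, \<phi> e)) ` E"
          using coloring_independent[OF \<phi>(2)] by blast
        ultimately obtain C where C: "C \<in> \<C>" "(\<lambda>e. (e, \<phi> e)) ` E \<subseteq> C" using \<C>(4) by meson
        then have "subtemplate E (coloring_template E \<phi>) (templ C)"
          unfolding subtemplate_def coloring_template_def templ_def by auto
        then show ?thesis using C(1) by blast
      qed
      show "real (card (rainbow_K4_copies V E L)) \<le> real r ^ 4 * real n powr (- 1 / 3) * real (n choose 4)"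
        if L: "L \<in> templ ` \<C>" for L
      proof -
        from L obtain C where C: "C \<in> \<C>" "L = templ C" by blast
        then have "C \<subseteq> E \<times> {1..r}" using \<C>(1) by blast
        from rainbow_K4_copies_restrict[OF this, of V] show ?thesis
          using \<C>(3) C unfolding templ_def by simp
      qed
      have "real (card (templ ` \<C>)) \<le> real (card \<C>)" using card_image_le[OF fin] by simp
      with \<C>(2) show "real (card (templ ` \<C>))
          \<le> 2 powr (c * real n powr (- 1 / 3) * real (n choose 2) * (log 2 (real n)) ^ 2)" by linarith
    qed
  qed
qed

end
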